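(* Let $n \geq 1$ be a fixed integer, and let $$\gamma : [-\pi,\pi] \to \mathbb{C}, \qquad \gamma(\alpha) = e^{i\alpha}\left(1 - \left(1 - e^{-i\alpha}\right)\tfrac{1}{n}\right)^n .$$ Then the image $\Pi_{\mathrm{d}}(\mathrm{SU}(n)) = \{\Pi_{\mathrm{d}}(U) : U \in \mathrm{SU}(n)\}$ is the compact region of the complex plane enclosed by (the image of) the closed curve $\gamma$. Moreover, for $U \in \mathrm{SU}(n)$, the diagonal product $\Pi_{\mathrm{d}}(U)$ is equal to $\gamma(\alpha)$ for some $\alpha \in [-\pi,\pi]$ if and only if $U$ is of the form $$U = \left(I - (1 - e^{-i\alpha})\, v v^\dagger\right) \operatorname{diag}(e^{i\alpha_1}, \ldots, e^{i\alpha_n})$$ for some $\alpha \in [-\pi,\pi]$, some $v \in \mathbb{C}^n$ satisfying $|v_k| = \tfrac{1}{\sqrt{n}}$ for all $k = 1,\ldots,n$, and some real numbers $\alpha_1,\ldots,\alpha_n$ satisfying $e^{i\sum_{k=1}^n \alpha_k} = e^{i\alpha}$.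
   Context: For an $n\times n$ complex matrix $A$, its diagonal product is $\Pi_{\mathrm{d}}(A) := \prod_{j=1}^n A_{jj}$. $\mathrm{SU}(n)$ is the group of $n\times n$ complex unitary matrices with determinant $1$. $I$ is the $n\times n$ identity matrix, and $v^\dagger$ denotes the conjugate transpose of the column vector $v$. The compact region enclosed by a closed curve means the union of the image of the curve with all bounded connected components of the complement of that image in $\mathbb{C}$; in the degenerate cases $n=1$ (where $\gamma \equiv 1$) and $n=2$ (where $\gamma(\alpha) = \cos^2\tfrac{\alpha}{2}$) this region is just the image of $\gamma$, namely $\{1\}$ and $[0,1]$ respectively. *)

theory Defs
  imports "HOL-Analysis.Analysis"
begin

definition conj_transpose :: "complex ^ 'n ^ 'm \<Rightarrow> complex ^ 'm ^ 'n" where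
  "conj_transpose A = map_matrix cnj (transpose A)"

definition special_unitary :: "(complex ^ 'n ^ 'n) set" where
  "special_unitary = {U. conj_transpose U ** U = mat 1 \<and> U ** conj_transpose U = mat 1 \<and> det U = 1}"

definition diag_prod :: "complex ^ 'n ^ 'n \<Rightarrow> complex" where
  "diag_prod A = (\<Prod>j\<in>UNIV. A $ j $ j)"

(* The rank-one matrix v v\<^sup>\<dagger>, i.e. the column v times its conjugate transpose. *)
definition self_outer :: "complex ^ 'n \<Rightarrow> complex ^ 'n ^ 'n" where
  "self_outer v = (\<chi> i j. v $ i * cnj (v $ j))"

definition diag_mat :: "complex ^ 'n \<Rightarrow> complex ^ 'n ^ 'n" where
  "diag_mat d = (\<chi> i j. if i = j then d $ i else 0)"

definition gamma_curve :: "nat \<Rightarrow> real \<Rightarrow> complex" where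
  "gamma_curve n \<alpha> = cis \<alpha> * (1 - (1 - cis (- \<alpha>)) * (1 / of_nat n)) ^ n"

(* For the image C of a closed curve, the constant inside gives the union of the bounded
   connected components of the complement of C; it is empty when C does not separate the
   plane, as happens for a point or a segment. *)
definition enclosed_region :: "complex set \<Rightarrow> complex set" where
  "enclosed_region C = C \<union> inside C"

end

theory Submission
  imports Defs "HOL-Complex_Analysis.Winding_Numbers"
begin

text \<open>Let \<open>\<gamma>\<close> denote the curve and \<open>n\<close> the dimension.  For \<open>n \<ge> 3\<close> the base of the power in \<open>\<gamma>\<close> stays in
  the right half plane, so \<open>\<gamma>\<close> has a smooth logarithm, and the angle of \<open>\<gamma>\<close> increases strictly from
  \<open>- pi\<close> to \<open>pi\<close>.  Hence \<open>\<gamma>\<close> is a simple closed curve and the region it encloses is the star-shaped set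
  of all \<open>s \<gamma>(\<alpha>)\<close> with \<open>0 \<le> s \<le> 1\<close>.

  The image lies in this region.  Rotating the columns of \<open>U\<close> turns its diagonal nonnegative, and the
  inequality of the means then shows that the diagonal product is a fraction of the value
  \<open>(tr A / n) ^ n / det A\<close> for a unitary matrix \<open>A\<close>, so it is enough to bound this trace ratio.  By
  compactness there is a unitary \<open>A\<close> with trace ratio \<open>E \<gamma>(\<alpha>)\<close> and \<open>E\<close> as large as possible.
  Multiplying \<open>A\<close> by rotations \<open>cis s\<close> in the direction of a unit vector \<open>v\<close> moves the trace ratio
  tangentially to the dilated curve (\<open>tangent_at_radial_maximum\<close>), and this for all \<open>v\<close> says that
  \<open>A / \<mu> - I\<close>, with \<open>\<mu>\<close> the mean of the diagonal, is a scalar \<open>D\<close> times a Hermitian matrix \<open>T\<close> of trace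
  zero.  Unitarity of \<open>A\<close> becomes a quadratic equation for \<open>T\<close>, so that \<open>T\<close> is an affine function of a
  projection.  The trace of a nonzero projection is at least one, which is precisely what is needed for
  \<open>E \<le> 1\<close>; in the case of equality the projection is some \<open>v v\<^sup>\<dagger>\<close>, and \<open>A\<close> is a scalar multiple of a phase
  reflection (\<open>extremal_unitary_is_phase_reflection\<close>).  Equality of the means makes the moduli
  of the entries of \<open>v\<close> equal.  So the same argument gives the inclusion and the matrices over the curve.

  The image fills the region.  The phase reflections in unit vectors that move from the uniform one to
  a coordinate vector contract \<open>\<gamma>\<close> to the point \<open>1\<close> inside the image, while \<open>\<gamma>\<close> winds once around
  every point that it encloses.

  For \<open>n = 1\<close> and \<open>n = 2\<close> the curve degenerates to a point and to a segment, and every special unitary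
  matrix has the reflection form, by an explicit choice of its parameters.\<close>

section \<open>Determinants of rank-one updates\<close>

lemma sum_mat_one [simp]:
  fixes f :: "'n::finite \<Rightarrow> 'a::comm_ring_1"
  shows "(\<Sum>k\<in>UNIV. mat 1 $ i $ k * f k) = f i"
    and "(\<Sum>k\<in>UNIV. mat 1 $ k $ i * f k) = f i"
    and "(\<Sum>k\<in>UNIV. f k * mat 1 $ i $ k) = f i"
    and "(\<Sum>k\<in>UNIV. f k * mat 1 $ k $ i) = f i"
  by (simp_all add: mat_def if_distrib if_distribR cong: if_cong)

lemma det_one_row_replaced:
  fixes w :: "'a::comm_ring_1 ^ 'n"
  shows "det (\<chi> i. if i = k then w else axis i 1) = w $ k"
proof -
  have unit_row: "det (\<chi> i. (if i = k then axis j 1 else axis i 1) :: 'a ^ 'n ^ 'n) = (if j = k then 1 else 0)" for j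
  proof (cases "j = k")
    case True
    have "(\<chi> i. (if i = k then axis j 1 else axis i 1)) = (mat 1 :: 'a ^ 'n ^ 'n)"
      using True by (auto simp: vec_eq_iff mat_def axis_def)
    then show ?thesis using True by simp
  next
    case False
    then have "det (\<chi> i. (if i = k then axis j 1 else axis i 1) :: 'a ^ 'n ^ 'n) = 0"
      by (intro det_identical_rows[of j k]) (auto simp: row_def vec_eq_iff)
    then show ?thesis using False by simp
  qed
  have "det (\<chi> i. if i = k then w else axis i 1)
      = det (\<chi> i. if i = k then (\<Sum>j\<in>UNIV. w $ j *s axis j 1) else axis i 1)"
    unfolding basis_expansion ..
  also have "\<dots> = (\<Sum>j\<in>UNIV. det (\<chi> i. if i = k then w $ j *s axis j 1 else axis i 1))"
    by (rule det_linear_row_sum) simp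
  also have "\<dots> = (\<Sum>j\<in>UNIV. w $ j * (if j = k then 1 else 0))"
    by (simp only: det_row_mul unit_row)
  also have "\<dots> = w $ k" by (simp add: if_distrib cong: if_cong)
  finally show ?thesis .
qed

text \<open>The row \<open>w\<close> itself cancels the multiples of \<open>w\<close> that were added to the other rows.\<close>

lemma det_replaced_row_rank_one_update:
  fixes a w :: "'a::comm_ring_1 ^ 'n"
  assumes "finite S" "k \<notin> S"
  shows "det (\<chi> i. if i = k then w else if i \<in> S then axis i 1 + a $ i *s w else axis i 1) = w $ k"
  using assms
proof (induction S rule: finite_induct)
  case empty
  then show ?case by (simp add: det_one_row_replaced cong: if_cong)
next
  case (insert j S)
  let ?N = "\<chi> i. if i = k then w else if i \<in> S then axis i 1 + a $ i *s w else axis i 1"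
  have "(\<chi> i. if i = k then w else if i \<in> insert j S then axis i 1 + a $ i *s w else axis i 1)
      = (\<chi> r. if r = j then row j ?N + a $ j *s row k ?N else row r ?N)"
    using insert by (auto simp: vec_eq_iff row_def)
  then show ?case using insert det_row_operation[of j k ?N "a $ j"] by auto
qed

text \<open>Switching on the multiples of \<open>w\<close> one row at a time, each row \<open>k\<close> contributes
  \<open>a $ k\<close> times a determinant in which \<open>w\<close> has replaced that row.\<close>

lemma det_rank_one_update:
  fixes a w :: "'a::comm_ring_1 ^ 'n"
  shows "det (\<chi> i. axis i 1 + a $ i *s w) = 1 + (\<Sum>i\<in>UNIV. a $ i * w $ i)"
proof -
  have "det (\<chi> i. if i \<in> S then axis i 1 + a $ i *s w else axis i 1) = 1 + (\<Sum>i\<in>S. a $ i * w $ i)"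
    if "finite S" for S
    using that
  proof (induction S rule: finite_induct)
    case empty
    have "(\<chi> i. axis i 1) = (mat 1 :: 'a ^ 'n ^ 'n)"
      by (simp add: vec_eq_iff mat_def axis_def)
    then show ?case by simp
  next
    case (insert k S)
    let ?c = "\<lambda>i. if i \<in> S then axis i 1 + a $ i *s w else axis i 1"
    have "(\<chi> i. if i \<in> insert k S then axis i 1 + a $ i *s w else axis i 1)
        = (\<chi> i. if i = k then axis i 1 + a $ k *s w else ?c i)"
      using insert by (auto simp: vec_eq_iff)
    then have "det (\<chi> i. if i \<in> insert k S then axis i 1 + a $ i *s w else axis i 1)
        = det (\<chi> i. if i = k then axis i 1 else ?c i) + a $ k * det (\<chi> i. if i = k then w else ?c i)"
      by (simp only: det_row_add det_row_mul)
    also have "(\<chi> i. if i = k then axis i 1 else ?c i) = (\<chi> i. ?c i)"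
      using insert by (auto simp: vec_eq_iff)
    also have "det \<dots> = 1 + (\<Sum>i\<in>S. a $ i * w $ i)" by (rule insert.IH)
    also have "det (\<chi> i. if i = k then w else ?c i) = w $ k"
      using insert by (intro det_replaced_row_rank_one_update)
    finally show ?case using insert by (simp add: algebra_simps)
  qed
  from this[of UNIV] show ?thesis by simp
qed

section \<open>Unitary matrices and phase reflections\<close>

definition unitary_matrices :: "(complex ^ 'n ^ 'n) set" where
  "unitary_matrices = {A. conj_transpose A ** A = mat 1 \<and> A ** conj_transpose A = mat 1}"

text \<open>For a unit vector \<open>v\<close> this multiplies \<open>v\<close> by \<open>cis (- \<alpha>)\<close> and fixes its orthogonal complement.
  For fixed \<open>v\<close> these matrices therefore form a one-parameter group.\<close>

definition phase_reflection :: "real \<Rightarrow> complex ^ 'n \<Rightarrow> complex ^ 'n ^ 'n" where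
  "phase_reflection \<alpha> v = mat 1 - map_matrix ((*) (1 - cis (- \<alpha>))) (self_outer v)"

lemma special_unitary_iff: "U \<in> special_unitary \<longleftrightarrow> U \<in> unitary_matrices \<and> det U = 1"
  by (auto simp: special_unitary_def unitary_matrices_def)

lemma conj_transpose_nth [simp]: "conj_transpose A $ i $ j = cnj (A $ j $ i)"
  by (simp add: conj_transpose_def transpose_def)

lemma phase_reflection_nth:
  "phase_reflection \<alpha> v $ i $ j = mat 1 $ i $ j - (1 - cis (- \<alpha>)) * (v $ i * cnj (v $ j))"
  by (simp add: phase_reflection_def self_outer_def)

lemma diag_mat_nth: "diag_mat d $ i $ j = mat 1 $ i $ j * d $ i"
  by (simp add: diag_mat_def mat_def)

lemma matrix_mul_nth: "(A ** B) $ i $ j = (\<Sum>k\<in>UNIV. A $ i $ k * B $ k $ j)"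
  by (simp add: matrix_matrix_mult_def)

lemma conj_transpose_conj_transpose [simp]: "conj_transpose (conj_transpose A) = A"
  by (simp add: vec_eq_iff)

lemma conj_transpose_mat_1 [simp]: "conj_transpose (mat 1) = mat 1"
  by (simp add: vec_eq_iff mat_def)

lemma conj_transpose_mul: "conj_transpose (A ** B) = conj_transpose B ** conj_transpose A"
  by (simp add: vec_eq_iff matrix_mul_nth mult.commute)

lemma det_conj_transpose: "det (conj_transpose A) = cnj (det A)"
proof -
  have "det (map_matrix cnj B) = cnj (det B)" for B :: "complex ^ 'm ^ 'm"
    by (simp add: det_def)
  from this[of "transpose A"] show ?thesis by (simp add: conj_transpose_def)
qed

lemma unitary_matrices_mul:
  assumes "A \<in> unitary_matrices" "B \<in> unitary_matrices"
  shows "A ** B \<in> unitary_matrices"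
proof -
  have "conj_transpose B ** conj_transpose A ** (A ** B) = conj_transpose B ** (conj_transpose A ** A) ** B"
       "A ** B ** (conj_transpose B ** conj_transpose A) = A ** (B ** conj_transpose B) ** conj_transpose A"
    by (simp_all add: matrix_mul_assoc)
  then show ?thesis using assms by (simp add: unitary_matrices_def conj_transpose_mul)
qed

lemma unitary_row_orthonormal:
  assumes "A \<in> unitary_matrices"
  shows "(\<Sum>k\<in>UNIV. A $ i $ k * cnj (A $ j $ k)) = mat 1 $ i $ j"
proof -
  have "(A ** conj_transpose A) $ i $ j = mat 1 $ i $ j"
    using assms by (simp add: unitary_matrices_def)
  then show ?thesis by (simp add: matrix_mul_nth)
qed

lemma unitary_row_norm:
  assumes "A \<in> unitary_matrices"
  shows "(\<Sum>k\<in>UNIV. (cmod (A $ i $ k))\<^sup>2) = 1"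
proof -
  have "complex_of_real (\<Sum>k\<in>UNIV. (cmod (A $ i $ k))\<^sup>2) = 1"
    using unitary_row_orthonormal[OF assms, of i i]
    by (simp only: of_real_sum complex_norm_square) (simp add: mat_def)
  then show ?thesis using of_real_eq_1_iff by blast
qed

lemma unitary_entry_norm_le_1:
  assumes "A \<in> unitary_matrices"
  shows "cmod (A $ i $ j) \<le> 1"
proof -
  have "(cmod (A $ i $ j))\<^sup>2 \<le> (\<Sum>k\<in>UNIV. (cmod (A $ i $ k))\<^sup>2)"
    by (rule member_le_sum) auto
  then show ?thesis using unitary_row_norm[OF assms, of i] by (simp add: abs_square_le_1)
qed

lemma unitary_det_norm:
  assumes "A \<in> unitary_matrices"
  shows "cmod (det A) = 1"
proof -
  have "det (conj_transpose A ** A) = 1" using assms by (simp add: unitary_matrices_def)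
  then have "cnj (det A) * det A = 1" by (simp add: det_mul det_conj_transpose)
  then have "(cmod (det A))\<^sup>2 = 1"
    by (metis complex_norm_square mult.commute of_real_eq_1_iff)
  then show ?thesis by (simp add: power2_eq_1_iff) (smt (verit) norm_ge_zero)
qed

lemma det_diag_mat: "det (diag_mat d) = (\<Prod>k\<in>UNIV. d $ k)"
  by (subst det_diagonal) (auto simp: diag_mat_def)

lemma mul_diag_mat_nth: "(A ** diag_mat d) $ i $ j = A $ i $ j * d $ j"
proof -
  have "(\<Sum>k\<in>UNIV. A $ i $ k * diag_mat d $ k $ j) = (\<Sum>k\<in>UNIV. (A $ i $ k * d $ k) * mat 1 $ k $ j)"
    by (simp add: diag_mat_nth mult_ac)
  also have "\<dots> = A $ i $ j * d $ j" by (rule sum_mat_one)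
  finally show ?thesis by (simp add: matrix_mul_nth)
qed

lemma diag_mat_unitary:
  assumes "\<And>k. cmod (d $ k) = 1"
  shows "diag_mat d \<in> unitary_matrices"
proof -
  have inverse: "diag_mat a ** diag_mat b = mat 1" if "\<And>k. a $ k * b $ k = 1" for a b :: "complex ^ 'n"
    using that by (auto simp: vec_eq_iff mul_diag_mat_nth diag_mat_nth mat_def)
  have "d $ k * cnj (d $ k) = 1" for k
    using assms[of k] by (simp add: complex_norm_square[symmetric])
  moreover have "conj_transpose (diag_mat d) = diag_mat (\<chi> k. cnj (d $ k))"
    by (auto simp: vec_eq_iff diag_mat_def)
  ultimately show ?thesis
    by (simp add: unitary_matrices_def inverse mult.commute)
qed

lemma unit_vector_cnj_sum:
  fixes v :: "complex ^ 'n"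
  assumes "(\<Sum>k\<in>UNIV. (cmod (v $ k))\<^sup>2) = 1"
  shows "(\<Sum>k\<in>UNIV. v $ k * cnj (v $ k)) = 1"
proof -
  have "(\<Sum>k\<in>UNIV. v $ k * cnj (v $ k)) = of_real (\<Sum>k\<in>UNIV. (cmod (v $ k))\<^sup>2)"
    by (simp only: of_real_sum complex_norm_square)
  then show ?thesis using assms by simp
qed

lemma phase_reflection_mul:
  assumes "(\<Sum>k\<in>UNIV. (cmod (v $ k))\<^sup>2) = 1"
  shows "phase_reflection \<alpha> v ** phase_reflection \<beta> v = phase_reflection (\<alpha> + \<beta>) v"
proof -
  let ?c = "1 - cis (- \<alpha>)" and ?d = "1 - cis (- \<beta>)"
  have "(phase_reflection \<alpha> v ** phase_reflection \<beta> v) $ i $ j = phase_reflection (\<alpha> + \<beta>) v $ i $ j" for i j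
  proof -
    have "(phase_reflection \<alpha> v ** phase_reflection \<beta> v) $ i $ j
        = (\<Sum>k\<in>UNIV. mat 1 $ i $ k * mat 1 $ k $ j
            - mat 1 $ i $ k * (?d * (v $ k * cnj (v $ j)))
            - (?c * (v $ i * cnj (v $ k))) * mat 1 $ k $ j
            + (?c * ?d * (v $ i * cnj (v $ j))) * (v $ k * cnj (v $ k)))"
      unfolding matrix_mul_nth phase_reflection_nth by (rule sum.cong) (simp_all add: algebra_simps)
    also have "\<dots> = mat 1 $ i $ j - ?d * (v $ i * cnj (v $ j)) - ?c * (v $ i * cnj (v $ j))
            + ?c * ?d * (v $ i * cnj (v $ j))"
      by (simp only: sum.distrib sum_subtractf sum_mat_one sum_distrib_left[symmetric]
          unit_vector_cnj_sum[OF assms] mult_1_right)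
    also have "\<dots> = mat 1 $ i $ j - (1 - cis (- \<alpha>) * cis (- \<beta>)) * (v $ i * cnj (v $ j))"
      by (simp add: algebra_simps)
    also have "\<dots> = phase_reflection (\<alpha> + \<beta>) v $ i $ j"
      by (simp add: phase_reflection_nth cis_mult)
    finally show ?thesis .
  qed
  then show ?thesis by (simp add: vec_eq_iff)
qed

lemma phase_reflection_unitary:
  assumes "(\<Sum>k\<in>UNIV. (cmod (v $ k))\<^sup>2) = 1"
  shows "phase_reflection \<alpha> v \<in> unitary_matrices"
proof -
  have "conj_transpose (phase_reflection \<alpha> v) = phase_reflection (- \<alpha>) v"
    by (simp add: vec_eq_iff phase_reflection_nth mat_def cis_cnj)
  moreover have "phase_reflection 0 v = mat 1"
    by (simp add: vec_eq_iff phase_reflection_nth)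
  ultimately show ?thesis
    using phase_reflection_mul[OF assms] by (simp add: unitary_matrices_def)
qed

lemma det_phase_reflection:
  assumes "(\<Sum>k\<in>UNIV. (cmod (v $ k))\<^sup>2) = 1"
  shows "det (phase_reflection \<alpha> v) = cis (- \<alpha>)"
proof -
  let ?a = "\<chi> i. - (1 - cis (- \<alpha>)) * v $ i" and ?w = "\<chi> i. cnj (v $ i)"
  have "phase_reflection \<alpha> v = (\<chi> i. axis i 1 + ?a $ i *s ?w)"
    by (simp add: vec_eq_iff phase_reflection_nth mat_def axis_def algebra_simps)
  then have "det (phase_reflection \<alpha> v) = 1 + (\<Sum>i\<in>UNIV. ?a $ i * ?w $ i)"
    using det_rank_one_update[of ?a ?w] by simp
  also have "\<dots> = 1 + (\<Sum>i\<in>UNIV. - (1 - cis (- \<alpha>)) * (v $ i * cnj (v $ i)))"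
    by (simp add: mult.assoc)
  also have "\<dots> = 1 - (1 - cis (- \<alpha>)) * (\<Sum>i\<in>UNIV. v $ i * cnj (v $ i))"
    by (simp only: sum_distrib_left[symmetric]) (simp add: algebra_simps)
  finally show ?thesis using unit_vector_cnj_sum[OF assms] by simp
qed

text \<open>The source of the extremal matrix on which the whole argument rests.\<close>

lemma compact_unitary_matrices: "compact (unitary_matrices :: (complex ^ 'n ^ 'n) set)"
proof -
  have "norm A \<le> (\<Sum>i\<in>(UNIV::'n set). \<Sum>j\<in>(UNIV::'n set). 1)"
    if "A \<in> unitary_matrices" for A :: "complex ^ 'n ^ 'n"
  proof -
    have "norm A \<le> (\<Sum>i\<in>UNIV. norm (A $ i))"
      unfolding norm_vec_def by (rule L2_set_le_sum) simp
    also have "\<dots> \<le> (\<Sum>i\<in>UNIV. \<Sum>j\<in>UNIV. cmod (A $ i $ j))"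
      unfolding norm_vec_def by (intro sum_mono L2_set_le_sum) simp
    also have "\<dots> \<le> (\<Sum>i\<in>(UNIV::'n set). \<Sum>j\<in>(UNIV::'n set). 1)"
      by (intro sum_mono unitary_entry_norm_le_1 that)
    finally show ?thesis .
  qed
  then have "bounded (unitary_matrices :: (complex ^ 'n ^ 'n) set)"
    unfolding bounded_iff by blast
  moreover have "closed (unitary_matrices :: (complex ^ 'n ^ 'n) set)"
    unfolding unitary_matrices_def vec_eq_iff matrix_mul_nth conj_transpose_nth
    by (intro closed_Collect_conj closed_Collect_all closed_Collect_eq continuous_intros)
  ultimately show ?thesis by (simp add: compact_eq_bounded_closed)
qed

lemma continuous_on_det:
  fixes f :: "'a::topological_space \<Rightarrow> complex ^ 'n ^ 'n"
  assumes "continuous_on S f"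
  shows "continuous_on S (\<lambda>x. det (f x))"
  unfolding det_def using assms by (intro continuous_intros)

section \<open>Projections and Hermitian matrices\<close>

lemma hermitian_idempotent_trace:
  fixes P :: "complex ^ 'n ^ 'n"
  assumes herm: "\<And>i j. P $ j $ i = cnj (P $ i $ j)"
    and idem: "\<And>i j. (\<Sum>k\<in>UNIV. P $ i $ k * P $ k $ j) = P $ i $ j"
  shows "P $ i $ i = of_real (\<Sum>k\<in>UNIV. (cmod (P $ i $ k))\<^sup>2)"
proof -
  have "P $ i $ i = (\<Sum>k\<in>UNIV. P $ i $ k * cnj (P $ i $ k))"
    using idem[of i i] by (simp only: herm[of _ i, symmetric])
  then show ?thesis by (simp only: of_real_sum complex_norm_square)
qed

text \<open>Any nonzero column of a projection is fixed by it, so the projection onto that column can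
  be split off, and the trace of what remains is a sum of squared moduli.\<close>

lemma hermitian_idempotent_trace_ge_1:
  fixes P :: "complex ^ 'n ^ 'n"
  assumes herm: "\<And>i j. P $ j $ i = cnj (P $ i $ j)"
    and idem: "\<And>i j. (\<Sum>k\<in>UNIV. P $ i $ k * P $ k $ j) = P $ i $ j"
    and "P \<noteq> 0"
  shows "Re (trace P) \<ge> 1"
    and "trace P = 1 \<Longrightarrow> \<exists>v. (\<Sum>k\<in>UNIV. (cmod (v $ k))\<^sup>2) = 1 \<and> P = self_outer v"
proof -
  note diag = hermitian_idempotent_trace[of P, OF herm idem]
  obtain m where m: "Re (P $ m $ m) > 0"
  proof (rule ccontr)
    assume no: "\<not> thesis"
    have "P $ i $ k = 0" for i k
    proof -
      have "(\<Sum>k\<in>UNIV. (cmod (P $ i $ k))\<^sup>2) \<le> 0"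
        using no that[of i] diag[of i] by (metis Re_complex_of_real not_le)
      moreover have "(cmod (P $ i $ k))\<^sup>2 \<le> (\<Sum>k\<in>UNIV. (cmod (P $ i $ k))\<^sup>2)"
        by (rule member_le_sum) auto
      ultimately have "(cmod (P $ i $ k))\<^sup>2 \<le> 0" by linarith
      then show ?thesis by simp
    qed
    then show False using \<open>P \<noteq> 0\<close> by (auto simp: vec_eq_iff)
  qed
  define q where "q = Re (P $ m $ m)"
  have q: "P $ m $ m = of_real q" "q > 0"
    using m diag[of m] by (auto simp: q_def)
  define v where "v = (\<chi> i. P $ i $ m / of_real (sqrt q))"
  have sq: "complex_of_real (sqrt q) * of_real (sqrt q) = of_real q"
    using q by (simp flip: of_real_mult)
  have sq0: "complex_of_real (sqrt q) \<noteq> 0" using q by simp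
  have vv: "v $ i * cnj (v $ j) = P $ i $ m * P $ m $ j / of_real q" for i j
    unfolding v_def by (simp add: herm[of j m] sq[symmetric])
  have unit: "(\<Sum>k\<in>UNIV. v $ k * cnj (v $ k)) = 1"
  proof -
    have "(\<Sum>k\<in>UNIV. P $ k $ m * P $ m $ k) = P $ m $ m"
      using idem[of m m] by (simp add: mult.commute)
    then show ?thesis using q by (simp add: vv sum_divide_distrib[symmetric])
  qed
  have Pv: "(\<Sum>k\<in>UNIV. P $ i $ k * v $ k) = v $ i" for i
    unfolding v_def using idem[of i m] by (simp add: sum_divide_distrib[symmetric])
  have vP: "(\<Sum>k\<in>UNIV. cnj (v $ k) * P $ k $ j) = cnj (v $ j)" for j
    using arg_cong[OF Pv[of j], of cnj] by (simp add: herm[of j] mult.commute)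
  define Q where "Q = P - self_outer v"
  have Q_nth: "Q $ i $ j = P $ i $ j - v $ i * cnj (v $ j)" for i j
    by (simp add: Q_def self_outer_def)
  have hermQ: "Q $ j $ i = cnj (Q $ i $ j)" for i j
    by (simp add: Q_nth herm[of j i] mult.commute)
  have idemQ: "(\<Sum>k\<in>UNIV. Q $ i $ k * Q $ k $ j) = Q $ i $ j" for i j
  proof -
    have "(\<Sum>k\<in>UNIV. Q $ i $ k * Q $ k $ j)
        = (\<Sum>k\<in>UNIV. P $ i $ k * P $ k $ j - (P $ i $ k * v $ k) * cnj (v $ j)
            - v $ i * (cnj (v $ k) * P $ k $ j) + (v $ i * cnj (v $ j)) * (v $ k * cnj (v $ k)))"
      unfolding Q_nth by (rule sum.cong) (simp_all add: algebra_simps)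
    also have "\<dots> = P $ i $ j - v $ i * cnj (v $ j) - v $ i * cnj (v $ j) + v $ i * cnj (v $ j)"
      by (simp only: sum.distrib sum_subtractf sum_distrib_left[symmetric]
          sum_distrib_right[symmetric] idem Pv vP unit mult_1_right)
    finally show ?thesis by (simp add: Q_nth)
  qed
  note diagQ = hermitian_idempotent_trace[of Q, OF hermQ idemQ]
  have trQ: "trace Q = trace P - 1"
    by (simp add: Q_def trace_sub) (simp add: trace_def self_outer_def unit)
  have trQ': "trace Q = of_real (\<Sum>i\<in>UNIV. \<Sum>k\<in>UNIV. (cmod (Q $ i $ k))\<^sup>2)"
    unfolding trace_def by (simp add: diagQ)
  have "Re (trace Q) \<ge> 0" unfolding trQ' Re_complex_of_real by (intro sum_nonneg) auto
  then show "Re (trace P) \<ge> 1" using trQ by simp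
  assume "trace P = 1"
  then have "(\<Sum>i\<in>UNIV. \<Sum>k\<in>UNIV. (cmod (Q $ i $ k))\<^sup>2) = 0"
    using trQ trQ' by (metis diff_self of_real_eq_0_iff)
  then have "Q = 0"
    by (simp add: sum_nonneg_eq_0_iff sum_nonneg vec_eq_iff)
  then have "P = self_outer v" by (simp add: Q_def)
  moreover have "(\<Sum>k\<in>UNIV. (cmod (v $ k))\<^sup>2) = 1"
  proof -
    have "complex_of_real (\<Sum>k\<in>UNIV. (cmod (v $ k))\<^sup>2) = 1"
      using unit by (simp only: of_real_sum complex_norm_square)
    then show ?thesis using of_real_eq_1_iff by blast
  qed
  ultimately show "\<exists>v. (\<Sum>k\<in>UNIV. (cmod (v $ k))\<^sup>2) = 1 \<and> P = self_outer v" by blast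
qed

lemma sum_mult_axis [simp]:
  fixes f :: "'n::finite \<Rightarrow> 'a::semiring_1"
  shows "(\<Sum>k\<in>UNIV. f k * (axis i a :: 'a ^ 'n) $ k) = f i * a"
proof -
  have "(\<Sum>k\<in>UNIV. f k * (axis i a :: 'a ^ 'n) $ k) = (\<Sum>k\<in>UNIV. if k = i then f i * a else 0)"
    by (rule sum.cong) (auto simp: axis_def)
  then show ?thesis by simp
qed

lemma quadratic_form_two_coordinates:
  fixes T :: "complex ^ 'n ^ 'n" and a b :: complex and i j :: 'n
  defines "v \<equiv> axis i a + axis j b"
  shows "(\<Sum>r\<in>UNIV. \<Sum>s\<in>UNIV. T $ r $ s * v $ s * cnj (v $ r))
    = cnj a * (T $ i $ i * a + T $ i $ j * b) + cnj b * (T $ j $ i * a + T $ j $ j * b)"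
proof -
  have two: "(\<Sum>k\<in>UNIV. f k * v $ k) = f i * a + f j * b" for f :: "'n \<Rightarrow> complex"
    by (simp add: v_def distrib_left sum.distrib)
  have "(\<Sum>r\<in>UNIV. \<Sum>s\<in>UNIV. T $ r $ s * v $ s * cnj (v $ r))
      = (\<Sum>r\<in>UNIV. (T $ r $ i * a + T $ r $ j * b) * cnj (v $ r))"
    by (simp only: sum_distrib_right[symmetric] two)
  also have "\<dots> = cnj (\<Sum>r\<in>UNIV. cnj (T $ r $ i * a + T $ r $ j * b) * v $ r)"
    by (simp add: mult.commute)
  also have "\<dots> = cnj a * (T $ i $ i * a + T $ i $ j * b) + cnj b * (T $ j $ i * a + T $ j $ j * b)"
    by (simp only: two) (simp add: mult.commute)
  finally show ?thesis .
qed

text \<open>Polarisation, using the unit vectors supported on two coordinates.  The weights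
  \<open>3/5\<close> and \<open>4/5\<close> have squares summing to one and avoid square roots.\<close>

lemma hermitian_if_quadratic_form_real:
  fixes T :: "complex ^ 'n ^ 'n"
  assumes real: "\<And>v :: complex ^ 'n. (\<Sum>k\<in>UNIV. (cmod (v $ k))\<^sup>2) = 1 \<Longrightarrow>
      Im (\<Sum>i\<in>UNIV. \<Sum>j\<in>UNIV. T $ i $ j * v $ j * cnj (v $ i)) = 0"
  shows "T $ j $ i = cnj (T $ i $ j)"
proof -
  have unit: "(\<Sum>k\<in>UNIV. (cmod ((axis p a + axis q b :: complex ^ 'n) $ k))\<^sup>2) = (cmod a)\<^sup>2 + (cmod b)\<^sup>2"
    if "p \<noteq> q \<or> b = 0" for p q a b
  proof -
    have "(\<Sum>k\<in>UNIV. (cmod ((axis p a + axis q b :: complex ^ 'n) $ k))\<^sup>2)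
        = (\<Sum>k\<in>UNIV. (if k = p then (cmod a)\<^sup>2 else 0) + (if k = q then (cmod b)\<^sup>2 else 0))"
      using that by (intro sum.cong) (auto simp: axis_def)
    then show ?thesis by (simp add: sum.distrib)
  qed
  have single: "Im (T $ p $ p) = 0" for p
    using real[of "axis p 1 + axis p 0"] unit[of p p 0 1]
    unfolding quadratic_form_two_coordinates by simp
  show ?thesis
  proof (cases "i = j")
    case True
    then show ?thesis using single[of i] by (simp add: complex_eq_iff)
  next
    case False
    have pair: "Im (T $ i $ j * b * cnj a + T $ j $ i * a * cnj b) = 0"
      if "(cmod a)\<^sup>2 + (cmod b)\<^sup>2 = 1" for a b
    proof -
      have "cnj a * (T $ i $ i * a + T $ i $ j * b) + cnj b * (T $ j $ i * a + T $ j $ j * b)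
          = T $ i $ i * of_real ((cmod a)\<^sup>2) + T $ j $ j * of_real ((cmod b)\<^sup>2)
            + (T $ i $ j * b * cnj a + T $ j $ i * a * cnj b)"
        by (simp only: complex_norm_square) (simp only: algebra_simps)
      moreover have "Im (cnj a * (T $ i $ i * a + T $ i $ j * b) + cnj b * (T $ j $ i * a + T $ j $ j * b)) = 0"
        using real[of "axis i a + axis j b"] unit[of i j b a] False that
        unfolding quadratic_form_two_coordinates by metis
      ultimately show ?thesis by (simp only: plus_complex.sel times_complex.sel Re_complex_of_real Im_complex_of_real single
          mult_zero_right mult_zero_left add_0 add_0_right diff_0_right)
    qed
    have rational: "Im (T $ i $ j * u + T $ j $ i * cnj u) = 0" if "cmod u = 1" for u
    proof -
      have "(cmod (of_real (3/5)))\<^sup>2 + (cmod (of_real (4/5) * u))\<^sup>2 = 1"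
        using that unfolding norm_mult norm_of_real by (simp add: power2_eq_square)
      then have "Im (T $ i $ j * (of_real (4/5) * u) * cnj (of_real (3/5))
          + T $ j $ i * of_real (3/5) * cnj (of_real (4/5) * u)) = 0" by (rule pair)
      moreover have "T $ i $ j * (of_real (4/5) * u) * cnj (of_real (3/5))
          + T $ j $ i * of_real (3/5) * cnj (of_real (4/5) * u)
          = of_real (12/25) * (T $ i $ j * u + T $ j $ i * cnj u)"
        by (simp add: field_simps)
      ultimately have "Im (of_real (12/25) * (T $ i $ j * u + T $ j $ i * cnj u)) = 0" by (simp only:)
      then show ?thesis
        by (simp only: times_complex.sel Re_complex_of_real Im_complex_of_real mult_zero_left
            add_0_right mult_eq_0_iff) simp
    qed
    have "Im (T $ i $ j) + Im (T $ j $ i) = 0" using rational[of 1] by simp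
    moreover have "Re (T $ i $ j) - Re (T $ j $ i) = 0" using rational[of \<i>] by simp
    ultimately show ?thesis by (simp add: complex_eq_iff)
  qed
qed

section \<open>The curve in polar form\<close>

definition curve_base :: "nat \<Rightarrow> real \<Rightarrow> complex" where
  "curve_base n \<alpha> = 1 - (1 - cis (- \<alpha>)) / of_nat n"

text \<open>A smooth logarithm of the curve: for \<open>n \<ge> 3\<close> the base stays in the right half plane, so the
  principal branch can be used, and the imaginary part is a continuous angle on all of \<open>\<real>\<close>.\<close>

definition log_curve :: "nat \<Rightarrow> real \<Rightarrow> complex" where
  "log_curve n \<alpha> = \<i> * of_real \<alpha> + of_nat n * Ln (curve_base n \<alpha>)"

text \<open>Up to the factor \<open>\<i> * (1 - 1 / n)\<close> this is the logarithmic derivative of the curve.  For the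
  extremal matrices it is also the factor relating \<open>A / \<mu> - I\<close> to a Hermitian matrix, where
  \<open>\<mu>\<close> is the mean of the diagonal.\<close>

definition curve_slope :: "nat \<Rightarrow> real \<Rightarrow> complex" where
  "curve_slope n \<alpha> = (1 - cis (- \<alpha>)) / curve_base n \<alpha>"

lemma gamma_curve_base: "gamma_curve n \<alpha> = cis \<alpha> * curve_base n \<alpha> ^ n"
  by (simp add: gamma_curve_def curve_base_def)

lemma gamma_curve_cong_cis:
  assumes "cis \<alpha> = cis \<beta>"
  shows "gamma_curve n \<alpha> = gamma_curve n \<beta>"
  using assms by (simp add: gamma_curve_def cis_cnj[symmetric])

lemma gamma_curve_0 [simp]: "gamma_curve n 0 = 1"
  by (simp add: gamma_curve_def)

lemma continuous_on_gamma_curve: "continuous_on S (gamma_curve n)"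
  unfolding gamma_curve_def[abs_def] cis_conv_exp by (intro continuous_intros)

lemma Re_curve_base_pos:
  assumes "n \<ge> 3"
  shows "Re (curve_base n \<alpha>) > 0"
proof -
  have "Re (curve_base n \<alpha>) = 1 - (1 - cos \<alpha>) / real n"
    by (simp add: curve_base_def Re_divide_of_nat)
  moreover have "(1 - cos \<alpha>) / real n \<le> 2 / real n"
    using cos_ge_minus_one[of \<alpha>] assms by (intro divide_right_mono) auto
  moreover have "2 / real n < 1" using assms by simp
  ultimately show ?thesis by linarith
qed

lemma curve_base_nonzero:
  assumes "n \<ge> 3"
  shows "curve_base n \<alpha> \<noteq> 0"
  using Re_curve_base_pos[OF assms, of \<alpha>] by auto

lemma curve_base_not_nonpos:
  assumes "n \<ge> 3"
  shows "curve_base n \<alpha> \<notin> \<real>\<^sub>\<le>\<^sub>0"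
  using Re_curve_base_pos[OF assms, of \<alpha>] by (auto simp: complex_nonpos_Reals_iff)

lemma gamma_curve_exp:
  assumes "n \<ge> 3"
  shows "gamma_curve n \<alpha> = exp (log_curve n \<alpha>)"
  using curve_base_nonzero[OF assms, of \<alpha>]
  by (simp add: gamma_curve_base log_curve_def exp_add cis_conv_exp exp_of_nat_mult)

lemma gamma_curve_nonzero:
  assumes "n \<ge> 3"
  shows "gamma_curve n \<alpha> \<noteq> 0"
  by (simp add: gamma_curve_exp[OF assms])

lemma one_plus_curve_slope:
  assumes "n \<ge> 3"
  shows "1 + curve_slope n \<alpha> / of_nat n = 1 / curve_base n \<alpha>"
  using curve_base_nonzero[OF assms, of \<alpha>] assms
  by (simp add: curve_slope_def field_simps) (simp add: curve_base_def field_simps)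

text \<open>The constant \<open>(n - 2) / n\<close> is what later becomes the linear coefficient of the quadratic equation
  for the extremal matrices.  For \<open>n \<ge> 3\<close> it makes the real part positive wherever the
  slope does not vanish, which says that the curve runs counterclockwise around the origin.\<close>

lemma Re_curve_slope:
  assumes "n > 0"
  shows "Re (curve_slope n \<alpha>) = (real n - 2) / (2 * real n) * (cmod (curve_slope n \<alpha>))\<^sup>2"
proof -
  let ?c = "1 - cis (- \<alpha>)" and ?B = "curve_base n \<alpha>"
  have c2: "(cmod ?c)\<^sup>2 = 2 * (1 - cos \<alpha>)"
  proof -
    have "(cmod ?c)\<^sup>2 = (1 - cos \<alpha>)\<^sup>2 + (sin \<alpha>)\<^sup>2"
      by (simp only: cmod_power2) simp
    also have "\<dots> = 2 * (1 - cos \<alpha>)"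
      using sin_cos_squared_add[of \<alpha>] by (simp add: power2_eq_square algebra_simps)
    finally show ?thesis .
  qed
  have "?c * cnj ?B = ?c - of_real ((cmod ?c)\<^sup>2) / of_nat n"
    unfolding complex_norm_square by (simp add: curve_base_def algebra_simps)
  then have "Re (?c * cnj ?B) = (1 - cos \<alpha>) - 2 * (1 - cos \<alpha>) / real n"
    by (simp only: c2) (simp add: Re_divide_of_nat)
  also have "\<dots> = (real n - 2) / (2 * real n) * (cmod ?c)\<^sup>2"
    unfolding c2 using assms by (simp add: field_simps)
  finally have "Re (?c * cnj ?B) / (cmod ?B)\<^sup>2 = (real n - 2) / (2 * real n) * (cmod ?c)\<^sup>2 / (cmod ?B)\<^sup>2"
    by (simp only:)
  moreover have "Re (?c / ?B) = Re (?c * cnj ?B) / (cmod ?B)\<^sup>2"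
    by (simp only: complex_div_cnj[of ?c] Re_divide_of_real flip: of_real_power)
  ultimately show ?thesis
    by (simp only: curve_slope_def norm_divide power_divide times_divide_eq_right)
qed

lemma log_curve_has_vector_derivative:
  assumes "n \<ge> 3"
  shows "(log_curve n has_vector_derivative \<i> * of_real (1 - 1 / real n) * curve_slope n \<alpha>) (at \<alpha>)"
proof -
  let ?B = "curve_base n \<alpha>"
  have cis: "((\<lambda>a. cis (- a)) has_vector_derivative - (\<i> * cis (- \<alpha>))) (at \<alpha>)"
  proof -
    have "((exp \<circ> (\<lambda>a. - \<i> * of_real a)) has_vector_derivative (- \<i> * of_real 1) * exp (- \<i> * of_real \<alpha>)) (at \<alpha>)"
      by (intro field_vector_diff_chain_at has_vector_derivative_mult_right has_vector_derivative_of_real DERIV_exp) simp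
    then show ?thesis by (simp add: cis_conv_exp comp_def)
  qed
  have "(curve_base n has_vector_derivative - (\<i> * cis (- \<alpha>)) / of_nat n) (at \<alpha>)"
    unfolding curve_base_def
    by (rule derivative_eq_intros cis refl | simp)+
  then have "((Ln \<circ> curve_base n) has_vector_derivative - (\<i> * cis (- \<alpha>)) / of_nat n * inverse ?B) (at \<alpha>)"
    by (rule field_vector_diff_chain_at) (rule has_field_derivative_Ln curve_base_not_nonpos assms)+
  then have "((\<lambda>a. of_nat n * (Ln \<circ> curve_base n) a) has_vector_derivative
      of_nat n * (- (\<i> * cis (- \<alpha>)) / of_nat n * inverse ?B)) (at \<alpha>)"
    by (rule has_vector_derivative_mult_right)
  then have "((\<lambda>a. \<i> * of_real a + of_nat n * (Ln \<circ> curve_base n) a) has_vector_derivative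
      \<i> * of_real 1 + of_nat n * (- (\<i> * cis (- \<alpha>)) / of_nat n * inverse ?B)) (at \<alpha>)"
    by (rule has_vector_derivative_add[rotated])
      (intro has_vector_derivative_mult_right has_vector_derivative_of_real DERIV_ident)
  moreover have "\<i> * of_real 1 + of_nat n * (- (\<i> * cis (- \<alpha>)) / of_nat n * inverse ?B)
      = \<i> * of_real (1 - 1 / real n) * curve_slope n \<alpha>"
  proof -
    have "\<i> * of_real 1 + of_nat n * (- (\<i> * cis (- \<alpha>)) / of_nat n * inverse ?B) = \<i> * (?B - cis (- \<alpha>)) / ?B"
    proof -
      have "of_nat n * (- (\<i> * cis (- \<alpha>)) / of_nat n * inverse ?B) = - (\<i> * cis (- \<alpha>)) / ?B"
        using assms by (simp add: divide_inverse)
      then show ?thesis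
        using curve_base_nonzero[OF assms, of \<alpha>] by (simp add: diff_divide_distrib right_diff_distrib)
    qed
    also have "?B - cis (- \<alpha>) = of_real (1 - 1 / real n) * (1 - cis (- \<alpha>))"
      by (simp add: curve_base_def algebra_simps diff_divide_distrib)
    finally show ?thesis by (simp add: curve_slope_def)
  qed
  ultimately show ?thesis by (simp add: log_curve_def[abs_def] comp_def)
qed

lemma Re_has_real_derivative:
  "(f has_vector_derivative f') (at x) \<Longrightarrow> ((\<lambda>x. Re (f x)) has_real_derivative Re f') (at x)"
  unfolding has_real_derivative_iff_has_vector_derivative
  by (rule bounded_linear.has_vector_derivative[OF bounded_linear_Re])

lemma Im_has_real_derivative:
  "(f has_vector_derivative f') (at x) \<Longrightarrow> ((\<lambda>x. Im (f x)) has_real_derivative Im f') (at x)"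
  unfolding has_real_derivative_iff_has_vector_derivative
  by (rule bounded_linear.has_vector_derivative[OF bounded_linear_Im])

lemma curve_angle_derivative:
  assumes "n \<ge> 3"
  shows "((\<lambda>a. Im (log_curve n a)) has_real_derivative (1 - 1 / real n) * Re (curve_slope n \<alpha>)) (at \<alpha>)"
  using Im_has_real_derivative[OF log_curve_has_vector_derivative[OF assms]] by simp

lemma curve_slope_eq_0_iff:
  assumes "n \<ge> 3"
  shows "curve_slope n \<alpha> = 0 \<longleftrightarrow> cis \<alpha> = 1"
proof -
  have "cis (- \<alpha>) = 1 \<longleftrightarrow> cis \<alpha> = 1"
    by (metis cis_cnj complex_cnj_one complex_cnj_cnj)
  moreover have "curve_slope n \<alpha> = 0 \<longleftrightarrow> cis (- \<alpha>) = 1"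
    using curve_base_nonzero[OF assms, of \<alpha>] by (auto simp: curve_slope_def)
  ultimately show ?thesis by blast
qed

lemma Re_curve_slope_nonneg:
  assumes "n \<ge> 3"
  shows "Re (curve_slope n \<alpha>) \<ge> 0"
  using assms by (subst Re_curve_slope) auto

lemma Re_curve_slope_pos:
  assumes "n \<ge> 3" "cis \<alpha> \<noteq> 1"
  shows "Re (curve_slope n \<alpha>) > 0"
  using assms curve_slope_eq_0_iff[of n \<alpha>] by (subst Re_curve_slope) auto

text \<open>The angular speed vanishes only where \<open>cis \<alpha> = 1\<close>, which is a discrete set.\<close>

lemma curve_angle_strict_mono:
  assumes "n \<ge> 3"
  shows "strict_mono (\<lambda>a. Im (log_curve n a))"
proof -
  let ?\<theta> = "\<lambda>a. Im (log_curve n a)"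
  have n1: "1 - 1 / real n > 0" using assms by simp
  have mono: "?\<theta> x \<le> ?\<theta> y" if "x \<le> y" for x y
    by (rule DERIV_nonneg_imp_nondecreasing[OF that])
      (use curve_angle_derivative[OF assms] Re_curve_slope_nonneg[OF assms] n1 in
        \<open>meson mult_nonneg_nonneg less_imp_le\<close>)
  have "?\<theta> x < ?\<theta> y" if "x < y" for x y
  proof (rule ccontr)
    assume "\<not> ?\<theta> x < ?\<theta> y"
    then have eq: "?\<theta> x = ?\<theta> y" using mono[of x y] that by linarith
    have const: "?\<theta> t = ?\<theta> x" if "x < t" "t < y" for t
      using mono[of x t] mono[of t y] that eq by linarith
    have one: "cis t = 1" if t: "x < t" "t < y" for t
    proof (rule ccontr)
      assume "cis t \<noteq> 1"
      have "(1 - 1 / real n) * Re (curve_slope n t) = 0"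
      proof (rule DERIV_local_const[OF curve_angle_derivative[OF assms], of "min (t - x) (y - t)"])
        show "\<forall>r. \<bar>t - r\<bar> < min (t - x) (y - t) \<longrightarrow> ?\<theta> t = ?\<theta> r"
          using const t by (auto simp: abs_less_iff)
      qed (use t in auto)
      then show False using n1 Re_curve_slope_pos[OF assms \<open>cis t \<noteq> 1\<close>] by simp
    qed
    define h where "h = min (y - x) 1 / 3"
    have h: "0 < h" "h < 1" "x + h < y" "x + 2 * h < y"
      using that by (auto simp: h_def min_def field_simps)
    have "cis (x + h) = 1" "cis (x + 2 * h) = 1"
      using one[of "x + h"] one[of "x + 2 * h"] h by auto
    then have "cis h = 1"
      by (metis (no_types, opaque_lifting) add.assoc cis_mult mult_1 mult_2)
    moreover have "sin h > 0"
      using h pi_gt3 by (intro sin_gt_zero) auto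
    ultimately show False by (simp add: complex_eq_iff)
  qed
  then show ?thesis by (rule strict_monoI)
qed

lemma curve_base_pi: "curve_base n pi = of_real (1 - 2 / real n)" "curve_base n (- pi) = of_real (1 - 2 / real n)"
  by (simp_all add: curve_base_def flip: cis_cnj)

lemma curve_angle_pi:
  assumes "n \<ge> 3"
  shows "Im (log_curve n pi) = pi" "Im (log_curve n (- pi)) = - pi"
proof -
  have "Im (Ln (of_real (1 - 2 / real n))) = 0"
    using assms by (subst Ln_of_real) auto
  then show "Im (log_curve n pi) = pi" "Im (log_curve n (- pi)) = - pi"
    by (simp_all only: log_curve_def curve_base_pi) (simp_all add: algebra_simps)
qed

lemma continuous_on_log_curve:
  assumes "n \<ge> 3"
  shows "continuous_on S (log_curve n)"
  by (meson assms continuous_at_imp_continuous_on has_vector_derivative_continuous log_curve_has_vector_derivative)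

text \<open>The angle of the curve sweeps from \<open>- pi\<close> to \<open>pi\<close>, so every ray from the origin meets the curve.\<close>

lemma complex_polar_gamma_curve:
  assumes "n \<ge> 3" "w \<noteq> 0"
  obtains \<alpha> E where "\<alpha> \<in> {-pi..pi}" "E > 0" "w = of_real E * gamma_curve n \<alpha>"
proof -
  have "\<exists>\<alpha>\<ge>- pi. \<alpha> \<le> pi \<and> Im (log_curve n \<alpha>) = Im (Ln w)"
    using curve_angle_pi[OF assms(1)] mpi_less_Im_Ln[OF assms(2)] Im_Ln_le_pi[OF assms(2)]
    by (intro IVT' continuous_on_Im continuous_on_log_curve assms(1)) auto
  then obtain \<alpha> where \<alpha>: "\<alpha> \<in> {-pi..pi}" "Im (log_curve n \<alpha>) = Im (Ln w)" by auto
  define E where "E = exp (Re (Ln w - log_curve n \<alpha>))"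
  have "Ln w - log_curve n \<alpha> = of_real (Re (Ln w - log_curve n \<alpha>))"
    using \<alpha> by (simp add: complex_eq_iff)
  then have "of_real E = exp (Ln w - log_curve n \<alpha>)"
    unfolding E_def by (metis exp_of_real)
  then have "w = of_real E * gamma_curve n \<alpha>"
    using assms by (simp add: gamma_curve_exp exp_diff)
  moreover have "E > 0" by (simp add: E_def)
  ultimately show thesis using that[OF \<alpha>(1)] by blast
qed

text \<open>The angle sweeps each direction only once, so no ray meets the curve in two points.\<close>

lemma gamma_curve_angle_unique:
  assumes "n \<ge> 3" "\<alpha> \<in> {-pi..pi}" "\<beta> \<in> {-pi..pi}" "E > 0" "E' > 0"
    and eq: "of_real E * gamma_curve n \<alpha> = of_real E' * gamma_curve n \<beta>"
  shows "\<alpha> = \<beta> \<or> {\<alpha>, \<beta>} = {-pi, pi}" "E = E'"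
proof -
  let ?\<theta> = "\<lambda>a. Im (log_curve n a)"
  have "exp (of_real (ln E) + log_curve n \<alpha>) = exp (of_real (ln E') + log_curve n \<beta>)"
    using eq assms by (simp add: exp_add exp_of_real gamma_curve_exp)
  then obtain k :: int where
    "of_real (ln E) + log_curve n \<alpha> = of_real (ln E') + log_curve n \<beta> + of_int (2 * k) * pi * \<i>"
    unfolding exp_eq by blast
  from arg_cong[OF this, of Im] have k: "?\<theta> \<alpha> = ?\<theta> \<beta> + of_int (2 * k) * pi"
    by simp
  have inj: "?\<theta> x \<le> ?\<theta> y \<longleftrightarrow> x \<le> y" for x y
    using curve_angle_strict_mono[OF assms(1)] by (rule strict_mono_less_eq)
  have range: "- pi \<le> ?\<theta> \<alpha>" "?\<theta> \<alpha> \<le> pi" "- pi \<le> ?\<theta> \<beta>" "?\<theta> \<beta> \<le> pi"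
    using curve_angle_pi[OF assms(1)] inj[of "- pi"] inj[of _ pi] assms(2,3) by auto
  have "\<bar>of_int (2 * k) * pi\<bar> \<le> 2 * pi" using k range by linarith
  then have "\<bar>real_of_int k\<bar> \<le> 1" using pi_gt_zero by (simp add: abs_mult)
  then consider "k = 0" | "k = 1" | "k = -1" by linarith
  then show angle: "\<alpha> = \<beta> \<or> {\<alpha>, \<beta>} = {-pi, pi}"
  proof cases
    case 1
    then have "?\<theta> \<alpha> = ?\<theta> \<beta>" using k by simp
    then show ?thesis using inj[of \<alpha> \<beta>] inj[of \<beta> \<alpha>] by auto
  next
    case 2
    then have "?\<theta> \<alpha> = pi" "?\<theta> \<beta> = - pi" using k range by auto
    then have "pi \<le> \<alpha>" "\<beta> \<le> - pi"
      using curve_angle_pi[OF assms(1)] inj[of pi \<alpha>] inj[of \<beta> "- pi"] by auto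
    then show ?thesis using assms(2,3) by auto
  next
    case 3
    then have "?\<theta> \<beta> = pi" "?\<theta> \<alpha> = - pi" using k range by auto
    then have "pi \<le> \<beta>" "\<alpha> \<le> - pi"
      using curve_angle_pi[OF assms(1)] inj[of pi \<beta>] inj[of \<alpha> "- pi"] by auto
    then show ?thesis using assms(2,3) by auto
  qed
  have "gamma_curve n (- pi) = gamma_curve n pi"
    by (rule gamma_curve_cong_cis) (simp add: complex_eq_iff)
  then have "gamma_curve n \<alpha> = gamma_curve n \<beta>" using angle by (metis doubleton_eq_iff)
  then show "E = E'" using eq gamma_curve_nonzero[OF assms(1)] by simp
qed

section \<open>Tangency at a radial maximum\<close>

text \<open>Here \<open>exp L\<close> is a curve that turns strictly around the origin and \<open>exp z\<close> is a curve that, near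
  \<open>0\<close>, stays inside its dilate by \<open>exp e\<close> and touches the dilate at \<open>z 0\<close>.  Measuring \<open>z\<close> against
  the point of \<open>L\<close> at the same angle gives a real function with a local maximum, and its vanishing
  derivative says that the two logarithmic velocities are parallel.\<close>

lemma tangent_at_radial_maximum:
  fixes L z :: "real \<Rightarrow> complex"
  assumes L: "(L has_vector_derivative L') (at a0)" "continuous_on UNIV L"
    and mono: "strict_mono (\<lambda>a. Im (L a))" and L': "Im L' \<noteq> 0"
    and z: "(z has_vector_derivative z') (at 0)" "z 0 = of_real e + L a0"
    and max: "\<forall>\<^sub>F s in at 0. \<forall>a. Im (z s) = Im (L a) \<longrightarrow> Re (z s) - Re (L a) \<le> e"
  shows "Re z' * Im L' = Im z' * Re L'"
proof -
  define \<theta> where "\<theta> = (\<lambda>a. Im (L a))"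
  define g where "g = inv \<theta>"
  have inj: "inj \<theta>" using mono unfolding \<theta>_def by (rule strict_mono_imp_inj_on)
  have g\<theta>: "g (\<theta> a) = a" for a unfolding g_def by (rule inv_f_f[OF inj])
  have cont: "continuous_on UNIV \<theta>" unfolding \<theta>_def by (intro continuous_on_Im L)
  have \<theta>g: "\<theta> (g y) = y" if "\<theta> (a0 - 1) < y" "y < \<theta> (a0 + 1)" for y
  proof -
    have "\<exists>x\<ge>a0 - 1. x \<le> a0 + 1 \<and> \<theta> x = y"
      by (rule IVT') (use that cont in \<open>auto intro: continuous_on_subset\<close>)
    then show ?thesis using g\<theta> by auto
  qed
  have ends: "\<theta> (a0 - 1) < \<theta> a0" "\<theta> a0 < \<theta> (a0 + 1)"
    using mono by (auto simp: \<theta>_def strict_mono_def)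
  have z0: "Im (z 0) = \<theta> a0" using z(2) by (simp add: \<theta>_def)
  have "(\<theta> has_real_derivative Im L') (at a0)"
    unfolding \<theta>_def by (rule Im_has_real_derivative[OF L(1)])
  moreover have "isCont g (\<theta> a0)"
    by (rule isCont_inverse_function[where d = 1])
      (use g\<theta> cont in \<open>auto simp: continuous_on_eq_continuous_at\<close>)
  ultimately have "(g has_real_derivative inverse (Im L')) (at (Im (z 0)))"
    unfolding z0 by (intro DERIV_inverse_function[of \<theta>, OF _ L' ends \<theta>g]) (auto simp: g\<theta>)
  then have "((\<lambda>s. g (Im (z s))) has_real_derivative inverse (Im L') * Im z') (at 0)"
    by (rule DERIV_chain2) (rule Im_has_real_derivative[OF z(1)])
  moreover have "((\<lambda>a. Re (L a)) has_real_derivative Re L') (at (g (Im (z 0))))"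
    unfolding z0 g\<theta> by (rule Re_has_real_derivative[OF L(1)])
  ultimately have "((\<lambda>s. Re (L (g (Im (z s))))) has_real_derivative Re L' * (inverse (Im L') * Im z')) (at 0)"
    by (rule DERIV_chain2[rotated])
  then have deriv: "((\<lambda>s. Re (z s) - Re (L (g (Im (z s))))) has_real_derivative
      Re z' - Re L' * (inverse (Im L') * Im z')) (at 0)"
    by (intro DERIV_diff Re_has_real_derivative[OF z(1)])
  have "isCont (\<lambda>s. Im (z s)) 0"
    using Im_has_real_derivative[OF z(1)] by (rule DERIV_isCont)
  then have tends: "((\<lambda>s. Im (z s)) \<longlongrightarrow> \<theta> a0) (at 0)" unfolding isCont_def z0 .
  have "\<forall>\<^sub>F s in at 0. \<theta> (a0 - 1) < Im (z s)" "\<forall>\<^sub>F s in at 0. Im (z s) < \<theta> (a0 + 1)"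
    using order_tendstoD[OF tends] ends by auto
  then have "\<forall>\<^sub>F s in at 0. Re (z s) - Re (L (g (Im (z s)))) \<le> e"
    using max
  proof eventually_elim
    case (elim s)
    then have "Im (z s) = Im (L (g (Im (z s))))" using \<theta>g by (simp add: \<theta>_def)
    then show ?case using elim by blast
  qed
  then obtain d where d: "d > 0"
    "\<And>s. s \<noteq> 0 \<Longrightarrow> dist s 0 < d \<Longrightarrow> Re (z s) - Re (L (g (Im (z s)))) \<le> e"
    unfolding eventually_at by auto
  have at0: "Re (z 0) - Re (L (g (Im (z 0)))) = e"
    unfolding z0 g\<theta> using z(2) by simp
  have "Re z' - Re L' * (inverse (Im L') * Im z') = 0"
  proof (rule DERIV_local_max[OF deriv d(1)], intro allI impI)
    fix y :: real assume "\<bar>0 - y\<bar> < d"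
    then show "Re (z y) - Re (L (g (Im (z y)))) \<le> Re (z 0) - Re (L (g (Im (z 0))))"
      unfolding at0 using d(2)[of y] at0 by (cases "y = 0") auto
  qed
  then show ?thesis using L' by (simp add: field_simps)
qed

section \<open>The extremal unitary matrices\<close>

text \<open>On unitary matrices \<open>cnj (det A)\<close> is the inverse of \<open>det A\<close>, so that the value does not change
  when \<open>A\<close> is multiplied by a scalar of modulus one; in this form it is continuous on all matrices.\<close>

definition trace_ratio :: "complex ^ 'n ^ 'n \<Rightarrow> complex" where
  "trace_ratio A = (trace A / of_nat CARD('n)) ^ CARD('n) * cnj (det A)"

lemma unitary_norm_trace_le:
  fixes A :: "complex ^ 'n ^ 'n"
  assumes "A \<in> unitary_matrices"
  shows "cmod (trace A / of_nat CARD('n)) \<le> 1"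
proof -
  have "cmod (trace A) \<le> (\<Sum>i\<in>(UNIV::'n set). cmod (A $ i $ i))"
    unfolding trace_def by (rule norm_sum)
  also have "\<dots> \<le> (\<Sum>i\<in>(UNIV::'n set). 1)"
    by (intro sum_mono unitary_entry_norm_le_1 assms)
  finally show ?thesis by (simp add: norm_divide divide_le_eq)
qed

lemma norm_trace_ratio:
  fixes A :: "complex ^ 'n ^ 'n"
  assumes "A \<in> unitary_matrices"
  shows "cmod (trace_ratio A) = cmod (trace A / of_nat CARD('n)) ^ CARD('n)"
  using unitary_det_norm[OF assms] by (simp add: trace_ratio_def norm_mult norm_power)

lemma trace_mul_phase_reflection:
  fixes A :: "complex ^ 'n ^ 'n"
  shows "trace (A ** phase_reflection (- s) v)
    = trace A + (cis s - 1) * (\<Sum>i\<in>UNIV. \<Sum>j\<in>UNIV. A $ i $ j * v $ j * cnj (v $ i))"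
proof -
  have "(A ** phase_reflection (- s) v) $ i $ i
      = A $ i $ i + (cis s - 1) * (\<Sum>j\<in>UNIV. A $ i $ j * v $ j * cnj (v $ i))" for i
  proof -
    have "(A ** phase_reflection (- s) v) $ i $ i
        = (\<Sum>j\<in>UNIV. A $ i $ j * mat 1 $ j $ i + (cis s - 1) * (A $ i $ j * v $ j * cnj (v $ i)))"
      unfolding matrix_mul_nth phase_reflection_nth by (rule sum.cong) (simp_all add: algebra_simps)
    then show ?thesis by (simp only: sum.distrib sum_mat_one sum_distrib_left)
  qed
  then show ?thesis by (simp add: trace_def sum.distrib sum_distrib_left)
qed

lemma log_one_plus_cis_has_vector_derivative:
  "((\<lambda>s. Ln (1 + (cis s - 1) * \<xi>)) has_vector_derivative \<i> * \<xi>) (at 0)"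
proof -
  have "((exp \<circ> (\<lambda>a. \<i> * of_real a)) has_vector_derivative (\<i> * of_real 1) * exp (\<i> * of_real 0)) (at 0)"
    by (intro field_vector_diff_chain_at has_vector_derivative_mult_right has_vector_derivative_of_real DERIV_exp) simp
  then have cis: "(cis has_vector_derivative \<i>) (at 0)"
    by (simp add: cis_conv_exp[abs_def] comp_def)
  have "((\<lambda>s. 1 + (cis s - 1) * \<xi>) has_vector_derivative \<i> * \<xi>) (at 0)"
    by (rule derivative_eq_intros cis refl | simp)+
  then have "((Ln \<circ> (\<lambda>s. 1 + (cis s - 1) * \<xi>)) has_vector_derivative \<i> * \<xi> * inverse (1 + (cis 0 - 1) * \<xi>)) (at 0)"
    by (rule field_vector_diff_chain_at) (rule has_field_derivative_Ln, simp)
  then show ?thesis by (simp add: comp_def)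
qed

text \<open>Moving \<open>A\<close> along \<open>A ** phase_reflection (- s) v\<close> adds \<open>cis s - 1\<close> times the quadratic form of
  \<open>v\<close> to the trace and multiplies the determinant by \<open>cis s\<close>.  The logarithmic velocity of the
  trace ratio is thus \<open>\<i>\<close> times the quadratic form of \<open>A / \<mu> - I\<close>, and it has to be parallel to that of
  the curve, which is \<open>\<i>\<close> times a real multiple of the slope.\<close>

lemma extremal_quadratic_form_real:
  fixes A :: "complex ^ 'n ^ 'n"
  assumes n: "CARD('n) \<ge> 3" and A: "A \<in> unitary_matrices" and "E > 0" and "cis \<alpha> \<noteq> 1"
    and eq: "trace_ratio A = of_real E * gamma_curve CARD('n) \<alpha>"
    and max: "\<And>B \<beta> F. (B :: complex ^ 'n ^ 'n) \<in> unitary_matrices \<Longrightarrow>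
      trace_ratio B = of_real F * gamma_curve CARD('n) \<beta> \<Longrightarrow> F \<le> E"
    and v: "(\<Sum>k\<in>UNIV. (cmod (v $ k))\<^sup>2) = 1"
  shows "Im (((\<Sum>i\<in>UNIV. \<Sum>j\<in>UNIV. A $ i $ j * v $ j * cnj (v $ i)) / (trace A / of_nat CARD('n)) - 1)
    / curve_slope CARD('n) \<alpha>) = 0"
proof -
  let ?n = "CARD('n)" and ?L = "log_curve CARD('n)" and ?D = "curve_slope CARD('n) \<alpha>"
  define q where "q = (\<Sum>i\<in>UNIV. \<Sum>j\<in>UNIV. A $ i $ j * v $ j * cnj (v $ i))"
  define \<xi> where "\<xi> = q / trace A"
  have tr0: "trace A \<noteq> 0"
  proof
    assume "trace A = 0"
    then have "trace_ratio A = 0" by (simp add: trace_ratio_def)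
    then show False using eq \<open>E > 0\<close> gamma_curve_nonzero[OF n] by simp
  qed
  define z where "z s = of_real (ln E) + ?L \<alpha> + of_nat ?n * Ln (1 + (cis s - 1) * \<xi>) - \<i> * of_real s" for s
  define z' where "z' = of_nat ?n * (\<i> * \<xi>) - \<i> * of_real 1"
  have "(z has_vector_derivative 0 + z') (at 0)"
    unfolding z_def z'_def add_diff_eq[symmetric] add.assoc[symmetric]
    by (intro has_vector_derivative_add has_vector_derivative_diff has_vector_derivative_mult_right
        has_vector_derivative_of_real DERIV_ident log_one_plus_cis_has_vector_derivative
        has_vector_derivative_const)
  then have z: "(z has_vector_derivative z') (at 0)" by simp
  have z0: "z 0 = of_real (ln E) + ?L \<alpha>" by (simp add: z_def)
  have "continuous (at 0) (\<lambda>s. 1 + (cis s - 1) * \<xi>)"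
    unfolding cis_conv_exp by (intro continuous_intros)
  then have "((\<lambda>s. 1 + (cis s - 1) * \<xi>) \<longlongrightarrow> 1) (at 0)"
    by (simp add: isCont_def)
  then have nz: "\<forall>\<^sub>F s in at 0. 1 + (cis s - 1) * \<xi> \<noteq> 0"
    by (rule tendsto_imp_eventually_ne) simp
  have "\<forall>\<^sub>F s in at 0. \<forall>a. Im (z s) = Im (?L a) \<longrightarrow> Re (z s) - Re (?L a) \<le> ln E"
    using nz
  proof (eventually_elim, intro allI impI)
    fix s a
    assume nz: "1 + (cis s - 1) * \<xi> \<noteq> 0" and im: "Im (z s) = Im (?L a)"
    let ?B = "A ** phase_reflection (- s) v"
    have "trace ?B = trace A * (1 + (cis s - 1) * \<xi>)"
      using tr0 by (simp add: trace_mul_phase_reflection \<xi>_def q_def field_simps)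
    moreover have "cnj (det ?B) = cnj (det A) * cis (- s)"
      by (simp add: det_mul det_phase_reflection[OF v] cis_cnj)
    ultimately have "trace_ratio ?B = trace_ratio A * (1 + (cis s - 1) * \<xi>) ^ ?n * cis (- s)"
      by (simp add: trace_ratio_def power_mult_distrib power_divide)
    also have "\<dots> = exp (z s)"
      using nz \<open>E > 0\<close> unfolding eq z_def gamma_curve_exp[OF n]
      by (simp add: exp_diff exp_add exp_of_real exp_of_nat_mult cis_conv_exp exp_minus field_simps)
    also have "\<dots> = exp (z s - ?L a) * gamma_curve ?n a"
      by (simp add: gamma_curve_exp[OF n] flip: exp_add)
    also have "z s - ?L a = of_real (Re (z s) - Re (?L a))"
      using im by (simp add: complex_eq_iff)
    finally have "trace_ratio ?B = of_real (exp (Re (z s) - Re (?L a))) * gamma_curve ?n a"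
      by (simp only: exp_of_real)
    then have "exp (Re (z s) - Re (?L a)) \<le> E"
      by (intro max[of ?B] unitary_matrices_mul A phase_reflection_unitary v)
    then show "Re (z s) - Re (?L a) \<le> ln E" using \<open>E > 0\<close> by (simp add: ln_ge_iff)
  qed
  moreover have "Im (\<i> * of_real (1 - 1 / real ?n) * ?D) \<noteq> 0"
    using Re_curve_slope_pos[OF n \<open>cis \<alpha> \<noteq> 1\<close>] n by simp
  ultimately have "Re z' * Im (\<i> * of_real (1 - 1 / real ?n) * ?D)
      = Im z' * Re (\<i> * of_real (1 - 1 / real ?n) * ?D)"
    by (intro tangent_at_radial_maximum[OF log_curve_has_vector_derivative[OF n]
          continuous_on_log_curve[OF n] curve_angle_strict_mono[OF n] _ z z0])
  moreover define X where "X = q / (trace A / of_nat ?n) - 1"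
  have "z' = \<i> * X"
    using tr0 by (simp add: z'_def X_def \<xi>_def field_simps)
  ultimately have "(1 - 1 / real ?n) * (Im X * Re ?D - Re X * Im ?D) = 0"
    by (simp add: algebra_simps)
  then have "Im X * Re ?D - Re X * Im ?D = 0"
    using n by auto
  then have "Im (X / ?D) = 0"
    by (simp add: Im_divide)
  then show ?thesis by (simp only: X_def q_def)
qed

text \<open>The heart of the argument.  By the first-order condition \<open>T = (A / \<mu> - I) / D\<close> is Hermitian,
  where \<open>D\<close> is the slope; its trace is zero.  Unitarity of \<open>A = \<mu> (I + D T)\<close> becomes
  \<open>T\<^sup>2 + c T = d I\<close> with \<open>c = 1 - 2 / n\<close>, so \<open>T = t I - (2 t + c) P\<close> for the nonnegative root \<open>t\<close> and a
  projection \<open>P\<close>.  Since the trace of \<open>P\<close> is at least one, \<open>t \<ge> 1 / n\<close>; since \<open>E \<ge> 1\<close> bounds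
  \<open>\<bar>\<mu>\<bar>\<close> from below and hence \<open>d\<close> from above, \<open>t \<le> 1 / n\<close>.  Equality makes \<open>P\<close> a projection of rank
  one and \<open>A\<close> a multiple of a phase reflection.\<close>

proposition extremal_unitary_is_phase_reflection:
  fixes A :: "complex ^ 'n ^ 'n"
  assumes n: "CARD('n) \<ge> 3" and A: "A \<in> unitary_matrices" and "E \<ge> 1"
    and \<alpha>: "\<alpha> \<in> {-pi..pi}" "\<alpha> \<noteq> 0"
    and eq: "trace_ratio A = of_real E * gamma_curve CARD('n) \<alpha>"
    and max: "\<And>B \<beta> F. (B :: complex ^ 'n ^ 'n) \<in> unitary_matrices \<Longrightarrow>
      trace_ratio B = of_real F * gamma_curve CARD('n) \<beta> \<Longrightarrow> F \<le> E"
  shows "E = 1"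
    and "\<exists>v \<omega>. (\<Sum>k\<in>UNIV. (cmod (v $ k))\<^sup>2) = 1 \<and> cmod \<omega> = 1
      \<and> (\<forall>i j. A $ i $ j = \<omega> * phase_reflection \<alpha> v $ i $ j)"
proof -
  have cis1: "cis \<alpha> \<noteq> 1"
  proof
    assume "cis \<alpha> = 1"
    then have "gamma_curve CARD('n) \<alpha> = gamma_curve CARD('n) 0" by (intro gamma_curve_cong_cis) simp
    then show False
      using gamma_curve_angle_unique(1)[OF n \<alpha>(1), of 0 1 1] \<alpha>(2) pi_gt_zero by (auto simp: doubleton_eq_iff)
  qed
  have "E > 0" using \<open>E \<ge> 1\<close> by simp
  define N where "N = real CARD('n)"
  have N: "N \<ge> 3" "complex_of_nat CARD('n) = of_real N" using n by (auto simp: N_def)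
  define \<mu> where "\<mu> = trace A / of_nat CARD('n)"
  define B where "B = curve_base CARD('n) \<alpha>"
  define D where "D = curve_slope CARD('n) \<alpha>"
  define c where "c = (N - 2) / N"
  define d where "d = (1 / (cmod \<mu>)\<^sup>2 - 1) / (cmod D)\<^sup>2"
  have c0: "c > 0" using N by (simp add: c_def)
  have B0: "B \<noteq> 0" unfolding B_def by (rule curve_base_nonzero[OF n])
  have D0: "D \<noteq> 0" using curve_slope_eq_0_iff[OF n] cis1 by (simp add: D_def)
  have D_B: "D = (1 - cis (- \<alpha>)) / B" by (simp add: D_def B_def curve_slope_def)
  have reD: "2 * Re D = c * (cmod D)\<^sup>2"
    using Re_curve_slope[of "CARD('n)" \<alpha>] n N(1) by (simp add: D_def c_def N_def field_simps)
  have invB: "1 + D / of_real N = 1 / B"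
    using one_plus_curve_slope[OF n, of \<alpha>] N by (simp add: D_def B_def)
  have norm_eq: "cmod \<mu> ^ CARD('n) = E * cmod B ^ CARD('n)"
    using arg_cong[OF eq, of cmod] norm_trace_ratio[OF A] \<open>E > 0\<close>
    by (simp add: \<mu>_def B_def gamma_curve_base norm_mult norm_power)
  have "cmod B ^ CARD('n) \<le> cmod \<mu> ^ CARD('n)"
    using \<open>E \<ge> 1\<close> mult_right_mono[of 1 E "cmod B ^ CARD('n)"] unfolding norm_eq by simp
  then have B_le: "cmod B \<le> cmod \<mu>"
    by (rule power_le_imp_le_base[of _ "CARD('n) - 1", simplified]) simp_all
  have \<mu>0: "\<mu> \<noteq> 0" using B_le B0 by auto
  have \<mu>1: "cmod \<mu> \<le> 1" unfolding \<mu>_def by (rule unitary_norm_trace_le[OF A])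

  \<comment> \<open>If \<open>\<mu>\<close> had the modulus of \<open>B\<close>, then \<open>d\<close> would be \<open>1 / N\<^sup>2 + c / N\<close>; a larger modulus lowers \<open>d\<close>.\<close>
  have d_curve: "1 / (cmod B)\<^sup>2 - 1 = (cmod D)\<^sup>2 * (1 / N\<^sup>2 + c / N)"
  proof -
    have "1 / (cmod B)\<^sup>2 = (cmod (1 + D / of_real N))\<^sup>2"
      unfolding invB by (simp add: norm_divide power_divide)
    also have "\<dots> = 1 + 2 * Re D / N + (cmod D)\<^sup>2 / N\<^sup>2"
      using N(1) by (simp add: cmod_power2) (simp add: field_simps power2_eq_square)
    finally show ?thesis unfolding reD by (simp add: algebra_simps)
  qed
  have "1 / (cmod \<mu>)\<^sup>2 \<le> 1 / (cmod B)\<^sup>2"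
    using B_le B0 by (intro divide_left_mono power_mono mult_pos_pos) auto
  then have "d \<le> (1 / (cmod B)\<^sup>2 - 1) / (cmod D)\<^sup>2"
    unfolding d_def by (intro divide_right_mono) auto
  then have d_le: "d \<le> 1 / N\<^sup>2 + c / N" unfolding d_curve using D0 by simp
  have d0: "d \<ge> 0"
    unfolding d_def using \<mu>1 \<mu>0 by (intro divide_nonneg_nonneg) (auto simp: power_le_one)

  define T where "T = (\<chi> i j. (A $ i $ j / \<mu> - mat 1 $ i $ j) / D)"
  have A_T: "A $ i $ j = \<mu> * (mat 1 $ i $ j + D * T $ i $ j)" for i j
    using D0 \<mu>0 by (simp add: T_def)
  have hermT: "T $ j $ i = cnj (T $ i $ j)" for i j
  proof (rule hermitian_if_quadratic_form_real)
    fix v :: "complex ^ 'n" assume v: "(\<Sum>k\<in>UNIV. (cmod (v $ k))\<^sup>2) = 1"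
    have "(\<Sum>j\<in>UNIV. T $ i $ j * v $ j * cnj (v $ i))
        = ((\<Sum>j\<in>UNIV. A $ i $ j * v $ j * cnj (v $ i)) / \<mu> - v $ i * cnj (v $ i)) / D" for i
    proof -
      have "(\<Sum>j\<in>UNIV. T $ i $ j * v $ j * cnj (v $ i))
          = (\<Sum>j\<in>UNIV. (A $ i $ j * v $ j * cnj (v $ i) / \<mu> - (mat 1 $ i $ j * v $ j) * cnj (v $ i)) / D)"
        by (rule sum.cong) (simp_all add: T_def diff_divide_distrib left_diff_distrib)
      also have "\<dots> = ((\<Sum>j\<in>UNIV. A $ i $ j * v $ j * cnj (v $ i)) / \<mu> - (\<Sum>j\<in>UNIV. mat 1 $ i $ j * v $ j) * cnj (v $ i)) / D"
        by (simp only: sum_divide_distrib[symmetric] sum_subtractf sum_distrib_right[symmetric])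
      finally show ?thesis by simp
    qed
    then have "(\<Sum>i\<in>UNIV. \<Sum>j\<in>UNIV. T $ i $ j * v $ j * cnj (v $ i))
        = ((\<Sum>i\<in>UNIV. \<Sum>j\<in>UNIV. A $ i $ j * v $ j * cnj (v $ i)) / \<mu> - 1) / D"
      by (simp only: sum_divide_distrib[symmetric] sum_subtractf unit_vector_cnj_sum[OF v])
    then show "Im (\<Sum>i\<in>UNIV. \<Sum>j\<in>UNIV. T $ i $ j * v $ j * cnj (v $ i)) = 0"
      using extremal_quadratic_form_real[OF n A \<open>E > 0\<close> cis1 eq max v] by (simp add: \<mu>_def D_def)
  qed
  have quadT: "(\<Sum>k\<in>UNIV. T $ i $ k * T $ k $ j) + of_real c * T $ i $ j = of_real d * mat 1 $ i $ j" for i j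
  proof -
    let ?S = "\<Sum>k\<in>UNIV. T $ i $ k * T $ k $ j"
    have "A $ i $ k * cnj (A $ j $ k) = \<mu> * cnj \<mu> *
        (mat 1 $ i $ k * mat 1 $ k $ j + D * (T $ i $ k * mat 1 $ k $ j)
          + cnj D * (mat 1 $ i $ k * T $ k $ j) + D * cnj D * (T $ i $ k * T $ k $ j))" for k
    proof -
      have "cnj (A $ j $ k) = cnj \<mu> * (mat 1 $ k $ j + cnj D * T $ k $ j)"
        unfolding A_T using hermT[of j k] by (simp add: mat_def)
      then show ?thesis unfolding A_T[of i k] by (simp add: algebra_simps)
    qed
    then have "mat 1 $ i $ j = \<mu> * cnj \<mu> * (mat 1 $ i $ j + (D + cnj D) * T $ i $ j + D * cnj D * ?S)"
      using unitary_row_orthonormal[OF A, of i j]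
      by (simp only: sum_distrib_left[symmetric] sum.distrib sum_mat_one) (simp add: algebra_simps)
    also have "D + cnj D = of_real (c * (cmod D)\<^sup>2)"
      unfolding reD[symmetric] by (simp add: complex_eq_iff)
    also have "D * cnj D = of_real ((cmod D)\<^sup>2)" by (simp only: complex_norm_square)
    also have "\<mu> * cnj \<mu> = of_real ((cmod \<mu>)\<^sup>2)" by (simp only: complex_norm_square)
    finally have *: "mat 1 $ i $ j = of_real ((cmod \<mu>)\<^sup>2) * (mat 1 $ i $ j
        + of_real ((cmod D)\<^sup>2) * (?S + of_real c * T $ i $ j))"
      by (simp add: algebra_simps)
    have "of_real ((cmod D)\<^sup>2) * (?S + of_real c * T $ i $ j) = of_real (1 / (cmod \<mu>)\<^sup>2 - 1) * mat 1 $ i $ j"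
    proof -
      have "of_real (1 / (cmod \<mu>)\<^sup>2) * mat 1 $ i $ j = mat 1 $ i $ j
          + of_real ((cmod D)\<^sup>2) * (?S + of_real c * T $ i $ j)"
        by (subst *) (use \<mu>0 in simp)
      then show ?thesis by (simp add: left_diff_distrib)
    qed
    then show ?thesis using D0 by (simp add: d_def field_simps)
  qed
  have trT: "trace T = 0"
  proof -
    have "trace T = (trace A / \<mu> - of_nat CARD('n)) / D"
      by (simp add: trace_def T_def sum_divide_distrib[symmetric] sum_subtractf mat_def)
    also have "trace A / \<mu> = of_nat CARD('n)" using \<mu>0 by (auto simp: \<mu>_def)
    finally show ?thesis by simp
  qed

  \<comment> \<open>The larger root \<open>t\<close> of the quadratic equation; the smaller one is \<open>- c - t\<close>.\<close>
  define t where "t = (sqrt (c\<^sup>2 + 4 * d) - c) / 2"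
  have t_root: "t\<^sup>2 + c * t = d"
  proof -
    have "(sqrt (c\<^sup>2 + 4 * d))\<^sup>2 = c\<^sup>2 + 4 * d" using d0 by simp
    then show ?thesis unfolding t_def by (simp add: power2_eq_square field_simps)
  qed
  have t0: "t \<ge> 0"
  proof -
    have "c \<le> sqrt (c\<^sup>2 + 4 * d)" using d0 c0 by (intro real_le_rsqrt) auto
    then show ?thesis by (simp add: t_def)
  qed
  have t_le: "t \<le> 1 / N"
  proof (rule ccontr)
    assume "\<not> t \<le> 1 / N"
    then have less: "1 / N < t" by simp
    have "(1 / N)\<^sup>2 < t\<^sup>2" using less N by (intro power_strict_mono) auto
    moreover have "c * (1 / N) < c * t" using less c0 by (rule mult_strict_left_mono)
    ultimately show False using t_root d_le by (simp add: power_divide)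
  qed
  define e where "e = 2 * t + c"
  have e0: "e > 0" using t0 c0 by (simp add: e_def)
  define P where "P = (\<chi> i j. (of_real t * mat 1 $ i $ j - T $ i $ j) / of_real e)"
  have T_P: "T $ i $ j = of_real t * mat 1 $ i $ j - of_real e * P $ i $ j" for i j
    using e0 by (simp add: P_def)
  have hermP: "P $ j $ i = cnj (P $ i $ j)" for i j
    using hermT[of j i] by (simp add: P_def mat_def)
  have idemP: "(\<Sum>k\<in>UNIV. P $ i $ k * P $ k $ j) = P $ i $ j" for i j
  proof -
    let ?S = "\<Sum>k\<in>UNIV. T $ i $ k * T $ k $ j"
    have "(\<Sum>k\<in>UNIV. P $ i $ k * P $ k $ j)
        = (\<Sum>k\<in>UNIV. (of_real (t\<^sup>2) * (mat 1 $ i $ k * mat 1 $ k $ j) - of_real t * (T $ i $ k * mat 1 $ k $ j)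
            - of_real t * (mat 1 $ i $ k * T $ k $ j) + T $ i $ k * T $ k $ j) / of_real (e * e))"
      by (rule sum.cong) (simp_all add: P_def algebra_simps power2_eq_square)
    also have "\<dots> = (of_real (t\<^sup>2) * mat 1 $ i $ j - of_real t * T $ i $ j - of_real t * T $ i $ j + ?S) / of_real (e * e)"
      by (simp only: sum_divide_distrib[symmetric] sum.distrib sum_subtractf sum_distrib_left[symmetric] sum_mat_one)
    also have "?S = of_real d * mat 1 $ i $ j - of_real c * T $ i $ j"
      using quadT[of i j] by (simp add: algebra_simps)
    also have "of_real (t\<^sup>2) * mat 1 $ i $ j - of_real t * T $ i $ j - of_real t * T $ i $ j
          + (of_real d * mat 1 $ i $ j - of_real c * T $ i $ j)
        = of_real e * (of_real t * mat 1 $ i $ j - T $ i $ j)"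
      unfolding t_root[symmetric] e_def by (simp add: algebra_simps power2_eq_square)
    finally show ?thesis using e0 by (simp add: P_def)
  qed
  have trP: "trace P = of_real (N * t / e)"
  proof -
    have "trace P = (of_real t * of_nat CARD('n) - trace T) / of_real e"
      by (simp add: trace_def P_def sum_divide_distrib[symmetric] sum_subtractf mat_def)
    then show ?thesis using trT N by (simp add: mult.commute)
  qed
  \<comment> \<open>\<open>P = 0\<close> would make \<open>A\<close> scalar, which puts \<open>trace_ratio A\<close> on the positive real axis.\<close>
  have "P \<noteq> 0"
  proof
    assume "P = 0"
    then have "t = 0" using trP N e0 by (simp add: trace_def)
    then have "T = 0" using T_P \<open>P = 0\<close> by (simp add: vec_eq_iff)
    then have "A = diag_mat (\<chi> k. \<mu>)" using A_T by (simp add: vec_eq_iff diag_mat_nth mult.commute)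
    then have "det A = \<mu> ^ CARD('n)" by (simp add: det_diag_mat)
    then have "trace_ratio A = (\<mu> * cnj \<mu>) ^ CARD('n)"
      by (simp add: trace_ratio_def \<mu>_def[symmetric] power_mult_distrib)
    also have "\<dots> = of_real (((cmod \<mu>)\<^sup>2) ^ CARD('n)) * gamma_curve CARD('n) 0"
      unfolding complex_norm_square[symmetric] by (simp add: gamma_curve_def)
    finally have "of_real E * gamma_curve CARD('n) \<alpha> = of_real (((cmod \<mu>)\<^sup>2) ^ CARD('n)) * gamma_curve CARD('n) 0"
      using eq by simp
    moreover have "((cmod \<mu>)\<^sup>2) ^ CARD('n) > 0" using \<mu>0 by simp
    ultimately have "\<alpha> = 0 \<or> {\<alpha>, 0} = {-pi, pi}"
      using gamma_curve_angle_unique(1)[OF n \<alpha>(1) _ \<open>E > 0\<close>, of 0] by simp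
    then show False using \<alpha>(2) by (auto simp: doubleton_eq_iff)
  qed
  note proj = hermitian_idempotent_trace_ge_1[of P, OF hermP idemP \<open>P \<noteq> 0\<close>]
  have "N * t / e \<ge> 1" using proj(1) unfolding trP by simp
  then have "(N - 2) * t \<ge> c" using e0 by (simp add: e_def le_divide_eq algebra_simps)
  then have "(N - 2) * (1 / N) \<le> (N - 2) * t" by (simp add: c_def)
  then have "t \<ge> 1 / N" using N by (simp only: mult_le_cancel_left_pos)
  then have t: "t = 1 / N" using t_le by simp
  then have e: "e = 1" using N by (simp add: e_def c_def field_simps)
  have "trace P = 1" unfolding trP t e using N by simp
  then obtain v where unit: "(\<Sum>k\<in>UNIV. (cmod (v $ k))\<^sup>2) = 1" and v: "P = self_outer v"
    using proj(2) by blast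
  have "d = 1 / N\<^sup>2 + c / N" using t_root t by (simp add: power_divide)
  then have "1 / (cmod \<mu>)\<^sup>2 - 1 = 1 / (cmod B)\<^sup>2 - 1"
    unfolding d_curve using D0 by (simp add: d_def field_simps)
  then have norm_\<mu>: "cmod \<mu> = cmod B" by simp
  then show "E = 1" using norm_eq B0 by simp
  have "A $ i $ j = \<mu> / B * phase_reflection \<alpha> v $ i $ j" for i j
  proof -
    have "A $ i $ j = \<mu> * ((1 + D / of_real N) * mat 1 $ i $ j - D * P $ i $ j)"
      unfolding A_T T_P t e by (simp add: algebra_simps)
    also have "\<dots> = \<mu> / B * phase_reflection \<alpha> v $ i $ j"
      unfolding invB by (simp add: D_B phase_reflection_nth v self_outer_def right_diff_distrib)
    finally show ?thesis .
  qed
  moreover have "cmod (\<mu> / B) = 1" using norm_\<mu> B0 by (simp add: norm_divide)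
  ultimately show "\<exists>v \<omega>. (\<Sum>k\<in>UNIV. (cmod (v $ k))\<^sup>2) = 1 \<and> cmod \<omega> = 1
       \<and> (\<forall>i j. A $ i $ j = \<omega> * phase_reflection \<alpha> v $ i $ j)"
    using unit by blast
qed

lemma continuous_on_trace_ratio: "continuous_on S (trace_ratio :: complex ^ 'n ^ 'n \<Rightarrow> complex)"
  unfolding trace_ratio_def[abs_def] trace_def
  by (intro continuous_intros continuous_on_det) simp_all

text \<open>Pairs of a unitary matrix and an angle at which its trace ratio lies on the ray through the curve
  form a compact set, on which the radial ratio \<open>E\<close> attains its maximum.  At the cusp \<open>\<alpha> = 0\<close>, where
  the tangent argument is not available, the curve has modulus one and the bound is trivial.\<close>

proposition trace_ratio_radial_bound:
  fixes A :: "complex ^ 'n ^ 'n"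
  assumes n: "CARD('n) \<ge> 3" and A: "A \<in> unitary_matrices"
    and eq: "trace_ratio A = of_real E * gamma_curve CARD('n) \<beta>"
  shows "E \<le> 1"
proof -
  let ?\<gamma> = "gamma_curve CARD('n)"
  define K where "K = ((unitary_matrices :: (complex ^ 'n ^ 'n) set) \<times> {-pi..pi}) \<inter>
    {p. trace_ratio (fst p) * cnj (?\<gamma> (snd p)) = of_real (cmod (trace_ratio (fst p)) * cmod (?\<gamma> (snd p)))}"
  define f where "f p = cmod (trace_ratio (fst p)) / cmod (?\<gamma> (snd p))" for p :: "(complex ^ 'n ^ 'n) \<times> real"
  have cont: "continuous_on S (\<lambda>p. trace_ratio (fst p))" "continuous_on S (\<lambda>p. ?\<gamma> (snd p))"
    for S :: "((complex ^ 'n ^ 'n) \<times> real) set"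
    by (rule continuous_on_compose2[OF continuous_on_trace_ratio continuous_on_fst[OF continuous_on_id] subset_UNIV]
        continuous_on_compose2[OF continuous_on_gamma_curve continuous_on_snd[OF continuous_on_id] subset_UNIV])+
  have "compact K"
    unfolding K_def
    by (intro compact_Int_closed compact_Times compact_unitary_matrices compact_Icc closed_Collect_eq
        continuous_on_mult continuous_on_cnj continuous_on_of_real continuous_on_norm cont)
  moreover have one: "(mat 1, 0) \<in> K"
    by (simp add: K_def unitary_matrices_def trace_ratio_def trace_I)
  moreover have "continuous_on K f"
    unfolding f_def using gamma_curve_nonzero[OF n] by (intro continuous_on_divide continuous_on_norm cont) auto
  moreover from one have "K \<noteq> {}" by blast
  ultimately obtain p where p: "p \<in> K" "\<And>q. q \<in> K \<Longrightarrow> f q \<le> f p"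
    using continuous_attains_sup[of K f] by blast
  obtain A0 \<alpha>0 where p_eq: "p = (A0, \<alpha>0)" by (cases p)
  have A0: "A0 \<in> unitary_matrices" and \<alpha>0: "\<alpha>0 \<in> {-pi..pi}"
    and real: "trace_ratio A0 * cnj (?\<gamma> \<alpha>0) = of_real (cmod (trace_ratio A0) * cmod (?\<gamma> \<alpha>0))"
    using p(1) by (auto simp: K_def p_eq)
  have eq0: "trace_ratio A0 = of_real (f p) * ?\<gamma> \<alpha>0"
  proof -
    have "trace_ratio A0 * (?\<gamma> \<alpha>0 * cnj (?\<gamma> \<alpha>0)) = of_real (cmod (trace_ratio A0) * cmod (?\<gamma> \<alpha>0)) * ?\<gamma> \<alpha>0"
      unfolding real[symmetric] by simp
    then show ?thesis
      using gamma_curve_nonzero[OF n, of \<alpha>0]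
      by (simp add: f_def p_eq complex_norm_square[symmetric] power2_eq_square field_simps)
  qed
  have f1: "f p \<ge> 1"
    using p(2)[OF one] by (simp add: f_def trace_ratio_def trace_I)
  have max: "F \<le> f p"
    if B: "B \<in> unitary_matrices" and B_eq: "trace_ratio B = of_real F * ?\<gamma> \<beta>"
    for B :: "complex ^ 'n ^ 'n" and \<beta> F
  proof (cases "F > 0")
    case True
    define \<beta>' where "\<beta>' = Arg (cis \<beta>)"
    have "cis \<beta>' = cis \<beta>" unfolding \<beta>'_def by (simp add: cis_Arg)
    then have B_eq': "trace_ratio B = of_real F * ?\<gamma> \<beta>'" using B_eq gamma_curve_cong_cis by metis
    have "trace_ratio B * cnj (?\<gamma> \<beta>') = of_real (cmod (trace_ratio B) * cmod (?\<gamma> \<beta>'))"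
    proof -
      have "?\<gamma> \<beta>' * cnj (?\<gamma> \<beta>') = of_real (cmod (?\<gamma> \<beta>')) * of_real (cmod (?\<gamma> \<beta>'))"
        by (simp only: complex_norm_square[symmetric] power2_eq_square of_real_mult)
      moreover have "cmod (of_real F * ?\<gamma> \<beta>') = F * cmod (?\<gamma> \<beta>')"
        using True by (simp add: norm_mult)
      ultimately show ?thesis unfolding B_eq' by (simp add: mult.assoc)
    qed
    moreover have "\<beta>' \<in> {-pi..pi}" using Arg_bounded[of "cis \<beta>"] by (auto simp: \<beta>'_def)
    ultimately have "(B, \<beta>') \<in> K" using B by (simp add: K_def)
    from p(2)[OF this] show ?thesis
      using True gamma_curve_nonzero[OF n, of \<beta>'] by (simp add: f_def B_eq' norm_mult)
  next
    case False
    then show ?thesis using f1 by linarith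
  qed
  have "f p = 1"
  proof (cases "\<alpha>0 = 0")
    case True
    then have "f p = cmod (trace_ratio A0)" by (simp add: f_def p_eq)
    also have "\<dots> \<le> 1"
      unfolding norm_trace_ratio[OF A0] using unitary_norm_trace_le[OF A0] by (intro power_le_one) auto
    finally show ?thesis using f1 by simp
  next
    case False
    then show ?thesis
      by (rule extremal_unitary_is_phase_reflection(1)[OF n A0 f1 \<alpha>0 _ eq0 max])
  qed
  then show ?thesis using max[OF A eq] by simp
qed

text \<open>By the radial bound such a matrix is itself extremal with \<open>E = 1\<close>.  A constant diagonal then forces all
  \<open>\<bar>v $ k\<bar>\<close> to agree.  At \<open>\<alpha> = 0\<close> the trace has the largest possible modulus and \<open>A\<close> is scalar.\<close>

lemma trace_ratio_on_curve:
  fixes A :: "complex ^ 'n ^ 'n"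
  assumes n: "CARD('n) \<ge> 3" and A: "A \<in> unitary_matrices" and \<alpha>: "\<alpha> \<in> {-pi..pi}"
    and eq: "trace_ratio A = gamma_curve CARD('n) \<alpha>"
    and diag: "\<And>j. A $ j $ j = m"
  shows "\<exists>v \<omega>. (\<forall>k. cmod (v $ k) = 1 / sqrt (real CARD('n))) \<and> cmod \<omega> = 1
    \<and> (\<forall>i j. A $ i $ j = \<omega> * phase_reflection \<alpha> v $ i $ j)"
proof (cases "\<alpha> = 0")
  case True
  have "trace A / of_nat CARD('n) = m" by (simp add: trace_def diag)
  then have "cmod m ^ CARD('n) = 1" using norm_trace_ratio[OF A] eq True by simp
  then have m: "cmod m = 1" using power_eq_imp_eq_base[of "cmod m" "CARD('n)" 1] by simp
  have off: "A $ i $ j = 0" if "i \<noteq> j" for i j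
  proof -
    have "(cmod (A $ i $ i))\<^sup>2 + (\<Sum>k\<in>UNIV - {i}. (cmod (A $ i $ k))\<^sup>2) = 1"
      using unitary_row_norm[OF A, of i] by (simp add: sum.remove[of UNIV i])
    then have "(\<Sum>k\<in>UNIV - {i}. (cmod (A $ i $ k))\<^sup>2) = 0" by (simp add: diag m)
    then have "(cmod (A $ i $ j))\<^sup>2 = 0"
      using that by (subst (asm) sum_nonneg_eq_0_iff) auto
    then show ?thesis by simp
  qed
  have "A $ i $ j = m * phase_reflection \<alpha> v $ i $ j" for i j and v :: "complex ^ 'n"
    using off[of i j] diag[of j] by (simp add: True phase_reflection_nth mat_def)
  moreover have "cmod ((\<chi> k. of_real (1 / sqrt (real CARD('n))) :: complex ^ 'n) $ k) = 1 / sqrt (real CARD('n))" for k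
    by (simp only: vec_lambda_beta norm_of_real) simp
  ultimately show ?thesis using m by blast
next
  case False
  obtain v \<omega> where unit: "(\<Sum>k\<in>UNIV. (cmod (v $ k))\<^sup>2) = 1" and \<omega>: "cmod \<omega> = 1"
    and form: "\<And>i j. A $ i $ j = \<omega> * phase_reflection \<alpha> v $ i $ j"
    using extremal_unitary_is_phase_reflection(2)[OF n A order_refl \<alpha> False]
      trace_ratio_radial_bound[OF n] eq by (metis mult_1 of_real_1)
  have cis1: "1 - cis (- \<alpha>) \<noteq> 0"
  proof
    assume "1 - cis (- \<alpha>) = 0"
    then have "cis (- \<alpha>) = cis 0" by simp
    then have "gamma_curve CARD('n) (- \<alpha>) = gamma_curve CARD('n) 0" by (intro gamma_curve_cong_cis) simp
    then show False
      using gamma_curve_angle_unique(1)[OF n, of "- \<alpha>" 0 1 1] \<alpha> False by (auto simp: doubleton_eq_iff)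
  qed
  define \<kappa> where "\<kappa> = (1 - m / \<omega>) / (1 - cis (- \<alpha>))"
  have \<kappa>: "of_real ((cmod (v $ k))\<^sup>2) = \<kappa>" for k
  proof -
    have "m = \<omega> * (1 - (1 - cis (- \<alpha>)) * of_real ((cmod (v $ k))\<^sup>2))"
      using form[of k k] unfolding diag phase_reflection_nth complex_norm_square by (simp add: mat_def)
    moreover have "\<omega> \<noteq> 0" using \<omega> by auto
    ultimately show ?thesis using cis1 by (simp add: \<kappa>_def)
  qed
  have "of_nat CARD('n) * \<kappa> = of_real (\<Sum>k\<in>UNIV. (cmod (v $ k))\<^sup>2)"
    by (simp only: of_real_sum \<kappa>) simp
  then have "\<kappa> = of_real (1 / real CARD('n))" unfolding unit by (simp add: field_simps)
  then have "(cmod (v $ k))\<^sup>2 = 1 / real CARD('n)" for k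
    using \<kappa>[of k] of_real_eq_iff by metis
  then have "cmod (v $ k) = 1 / sqrt (real CARD('n))" for k
    by (metis norm_ge_zero real_sqrt_divide real_sqrt_one real_sqrt_unique)
  then show ?thesis using \<omega> form by blast
qed

section \<open>From the trace to the diagonal product\<close>

text \<open>The inequality of the arithmetic and geometric means with its equality case, both from
  \<open>x \<le> exp (x - 1)\<close> applied to the quotients \<open>d j / m\<close>.\<close>

lemma prod_le_mean_power:
  fixes d :: "'i::finite \<Rightarrow> real"
  assumes d: "\<And>j. d j \<ge> 0" and mean: "(\<Sum>j\<in>UNIV. d j) = real CARD('i) * m"
  shows "(\<Prod>j\<in>UNIV. d j) \<le> m ^ CARD('i)"
    and "(\<Prod>j\<in>UNIV. d j) = m ^ CARD('i) \<Longrightarrow> m > 0 \<Longrightarrow> d j = m"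
proof -
  have m0: "m \<ge> 0"
  proof -
    have "0 \<le> real CARD('i) * m" unfolding mean[symmetric] by (intro sum_nonneg d)
    then show ?thesis by (simp add: zero_le_mult_iff)
  qed
  have exp_prod: "(\<Prod>j\<in>UNIV. exp (d j / m - 1)) = 1" if "m > 0"
  proof -
    have "(\<Sum>j\<in>UNIV. d j / m - 1) = 0"
      using mean that by (simp add: sum_subtractf sum_divide_distrib[symmetric])
    then show ?thesis by (simp flip: exp_sum)
  qed
  have scaled: "(\<Prod>j\<in>UNIV. d j) = m ^ CARD('i) * (\<Prod>j\<in>UNIV. d j / m)" if "m > 0"
    using that by (simp add: prod_dividef)
  have le: "d j / m \<le> exp (d j / m - 1)" for j
    using exp_ge_add_one_self[of "d j / m - 1"] by simp
  show "(\<Prod>j\<in>UNIV. d j) \<le> m ^ CARD('i)"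
  proof (cases "m > 0")
    case True
    have "(\<Prod>j\<in>UNIV. d j / m) \<le> (\<Prod>j\<in>UNIV. exp (d j / m - 1))"
      using d m0 le by (intro prod_mono) auto
    then show ?thesis using True by (simp add: scaled exp_prod mult_le_cancel_left1)
  next
    case False
    then have "(\<Sum>j\<in>UNIV. d j) = 0" using m0 mean by simp
    then have "d j = 0" for j using d by (simp add: sum_nonneg_eq_0_iff)
    then show ?thesis using m0 by simp
  qed
  assume eq: "(\<Prod>j\<in>UNIV. d j) = m ^ CARD('i)" and "m > 0"
  show "d j = m"
  proof (rule ccontr)
    assume "d j \<noteq> m"
    then have ne: "d j / m \<noteq> 1" using \<open>m > 0\<close> by simp
    have "d j / m \<noteq> exp (d j / m - 1)"
    proof
      assume fixed: "d j / m = exp (d j / m - 1)"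
      then have "d j / m > 0" by (metis exp_gt_zero)
      moreover have "ln (d j / m) = d j / m - 1" using fixed by (metis ln_exp)
      ultimately show False using ln_eq_minus_one ne by blast
    qed
    then have less: "d j / m < exp (d j / m - 1)"
      using le[of j] by simp
    have "(\<Prod>k\<in>UNIV. d k / m) = d j / m * (\<Prod>k\<in>UNIV - {j}. d k / m)"
      by (simp add: prod.remove[of UNIV j])
    also have "\<dots> \<le> d j / m * (\<Prod>k\<in>UNIV - {j}. exp (d k / m - 1))"
      using d m0 le by (intro mult_left_mono prod_mono) auto
    also have "\<dots> < exp (d j / m - 1) * (\<Prod>k\<in>UNIV - {j}. exp (d k / m - 1))"
      by (intro mult_strict_right_mono less prod_pos) auto
    also have "\<dots> = 1"
      using exp_prod[OF \<open>m > 0\<close>] by (simp add: prod.remove[of UNIV j])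
    finally show False using scaled[OF \<open>m > 0\<close>] eq \<open>m > 0\<close> by simp
  qed
qed

text \<open>Rotating the columns makes the diagonal nonnegative; the phases removed from the diagonal product
  reappear in the determinant.\<close>

lemma phase_normalised_diagonal:
  fixes U :: "complex ^ 'n ^ 'n"
  assumes U: "U \<in> special_unitary"
  obtains \<phi> :: "complex ^ 'n" where
    "\<And>k. cmod (\<phi> $ k) = 1"
    "\<And>k. (U ** diag_mat \<phi>) $ k $ k = of_real (cmod (U $ k $ k))"
    "diag_prod U = of_real (\<Prod>k\<in>UNIV. cmod (U $ k $ k)) * cnj (det (U ** diag_mat \<phi>))"
proof
  let ?\<phi> = "\<chi> k. if U $ k $ k = 0 then 1 else cnj (U $ k $ k) / of_real (cmod (U $ k $ k))"
  show "cmod (?\<phi> $ k) = 1" for k by (simp add: norm_divide)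
  show "(U ** diag_mat ?\<phi>) $ k $ k = of_real (cmod (U $ k $ k))" for k
  proof (cases "U $ k $ k = 0")
    case False
    have "U $ k $ k * cnj (U $ k $ k) = of_real (cmod (U $ k $ k)) * of_real (cmod (U $ k $ k))"
      by (simp only: complex_norm_square[symmetric] power2_eq_square of_real_mult)
    then show ?thesis using False by (simp add: mul_diag_mat_nth)
  qed (simp add: mul_diag_mat_nth)
  have "det (U ** diag_mat ?\<phi>) = (\<Prod>k\<in>UNIV. ?\<phi> $ k)"
    using U by (simp only: det_mul det_diag_mat) (simp add: special_unitary_def)
  moreover have "U $ k $ k = of_real (cmod (U $ k $ k)) * cnj (?\<phi> $ k)" for k
    by simp
  then have "diag_prod U = (\<Prod>k\<in>UNIV. of_real (cmod (U $ k $ k)) * cnj (?\<phi> $ k))"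
    unfolding diag_prod_def by (rule prod.cong[OF refl])
  ultimately show "diag_prod U = of_real (\<Prod>k\<in>UNIV. cmod (U $ k $ k)) * cnj (det (U ** diag_mat ?\<phi>))"
    by (simp only: prod.distrib of_real_prod cnj_prod)
qed

lemma cis_sum: "finite S \<Longrightarrow> cis (\<Sum>k\<in>S. a k) = (\<Prod>k\<in>S. cis (a k))"
  by (induction S rule: finite_induct) (simp_all add: cis_mult[symmetric])

text \<open>After normalising the phases, the diagonal product is a fraction of the trace ratio by the inequality
  of the means, and the trace ratio lies in the star region.  For a diagonal product on the curve
  both estimates have to be equalities.\<close>

proposition diag_prod_in_star_region:
  fixes U :: "complex ^ 'n ^ 'n"
  assumes n: "CARD('n) \<ge> 3" and U: "U \<in> special_unitary"
  shows "\<exists>s\<in>{0..1}. \<exists>\<alpha>\<in>{-pi..pi}. diag_prod U = of_real s * gamma_curve CARD('n) \<alpha>"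
    and "\<alpha> \<in> {-pi..pi} \<Longrightarrow> diag_prod U = gamma_curve CARD('n) \<alpha> \<Longrightarrow>
      \<exists>(v :: complex ^ 'n) (a :: real ^ 'n). (\<forall>k. cmod (v $ k) = 1 / sqrt (real CARD('n)))
        \<and> cis (\<Sum>k\<in>UNIV. a $ k) = cis \<alpha>
        \<and> U = phase_reflection \<alpha> v ** diag_mat (\<chi> k. cis (a $ k))"
proof -
  obtain \<phi> where \<phi>: "\<And>k. cmod (\<phi> $ k) = 1"
    and diag: "\<And>k. (U ** diag_mat \<phi>) $ k $ k = of_real (cmod (U $ k $ k))"
    and prod: "diag_prod U = of_real (\<Prod>k\<in>UNIV. cmod (U $ k $ k)) * cnj (det (U ** diag_mat \<phi>))"
    using phase_normalised_diagonal[OF U] by blast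
  define A where "A = U ** diag_mat \<phi>"
  have A: "A \<in> unitary_matrices"
    using U unfolding A_def by (intro unitary_matrices_mul diag_mat_unitary \<phi>) (simp add: special_unitary_iff)
  define p where "p = (\<Prod>k\<in>UNIV. cmod (U $ k $ k))"
  define m where "m = (\<Sum>k\<in>UNIV. cmod (U $ k $ k)) / real CARD('n)"
  have mean: "(\<Sum>k\<in>UNIV. cmod (U $ k $ k)) = real CARD('n) * m" by (simp add: m_def)
  have m0: "m \<ge> 0" unfolding m_def by (intro divide_nonneg_nonneg sum_nonneg) auto
  have p_le: "p \<le> m ^ CARD('n)"
    unfolding p_def by (rule prod_le_mean_power(1)[OF _ mean]) simp
  have pow0: "(0::real) ^ CARD('n) = 0" by (simp add: zero_power)
  have p0: "p \<ge> 0" unfolding p_def by (intro prod_nonneg) auto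
  have trA: "trace A / of_nat CARD('n) = of_real m"
    by (simp add: trace_def A_def diag m_def)
  have tr: "trace_ratio A = of_real (m ^ CARD('n)) * cnj (det A)"
    unfolding trace_ratio_def trA by simp
  have dp: "diag_prod U = of_real p * cnj (det A)" using prod by (simp add: A_def p_def)
  show "\<exists>s\<in>{0..1}. \<exists>\<alpha>\<in>{-pi..pi}. diag_prod U = of_real s * gamma_curve CARD('n) \<alpha>"
  proof (cases "m = 0")
    case True
    then have "p = 0" using p_le p0 pow0 by simp
    then have "diag_prod U = of_real 0 * gamma_curve CARD('n) 0" using dp by simp
    moreover have "(0::real) \<in> {-pi..pi}" by simp
    ultimately show ?thesis by (intro bexI[of _ 0]) auto
  next
    case False
    have "trace_ratio A \<noteq> 0" using False unitary_det_norm[OF A] unfolding tr by auto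
    then obtain \<alpha> E where \<alpha>: "\<alpha> \<in> {-pi..pi}" and "E > 0" and E: "trace_ratio A = of_real E * gamma_curve CARD('n) \<alpha>"
      using complex_polar_gamma_curve[OF n] by metis
    define s where "s = p / m ^ CARD('n) * E"
    have "E \<le> 1" by (rule trace_ratio_radial_bound[OF n A E])
    moreover have "p / m ^ CARD('n) \<le> 1" "p / m ^ CARD('n) \<ge> 0"
      using p_le p0 m0 False by (auto simp: divide_le_eq)
    ultimately have "0 \<le> p / m ^ CARD('n) * E" "p / m ^ CARD('n) * E \<le> 1"
      using \<open>E > 0\<close> by (simp_all only: mult_le_one mult_nonneg_nonneg less_imp_le)
    then have "s \<in> {0..1}" by (simp add: s_def)
    moreover have "diag_prod U = of_real s * gamma_curve CARD('n) \<alpha>"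
    proof -
      have "diag_prod U = of_real (p / m ^ CARD('n)) * trace_ratio A"
        unfolding tr dp using False by simp
      then show ?thesis unfolding E s_def by simp
    qed
    ultimately show ?thesis using \<alpha> by blast
  qed
  assume \<alpha>: "\<alpha> \<in> {-pi..pi}" and on: "diag_prod U = gamma_curve CARD('n) \<alpha>"
  have "p \<noteq> 0" using on dp gamma_curve_nonzero[OF n, of \<alpha>] by auto
  then have p: "p > 0" using p0 by simp
  then have m: "m > 0" using p_le m0 pow0 by (cases "m = 0") auto
  have E: "trace_ratio A = of_real (m ^ CARD('n) / p) * gamma_curve CARD('n) \<alpha>"
    unfolding on[symmetric] tr dp using p by simp
  have "m ^ CARD('n) / p \<le> 1" by (rule trace_ratio_radial_bound[OF n A E])
  then have p_eq: "p = m ^ CARD('n)" using p_le p by (simp add: divide_le_eq)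
  have all: "cmod (U $ k $ k) = m" for k
    by (rule prod_le_mean_power(2)[OF _ mean _ m]) (use p_eq in \<open>simp_all add: p_def\<close>)
  have on': "trace_ratio A = gamma_curve CARD('n) \<alpha>" using E p m p_eq by simp
  obtain v \<omega> where v: "\<forall>k. cmod (v $ k) = 1 / sqrt (real CARD('n))" and \<omega>: "cmod \<omega> = 1"
    and form: "\<And>i j. A $ i $ j = \<omega> * phase_reflection \<alpha> v $ i $ j"
    using trace_ratio_on_curve[OF n A \<alpha> on', of "of_real m"] by (metis A_def diag all)
  define a where "a = (\<chi> k. Arg (\<omega> * cnj (\<phi> $ k)))"
  have cis_a: "cis (a $ k) = \<omega> * cnj (\<phi> $ k)" for k
  proof -
    have one: "cmod (\<omega> * cnj (\<phi> $ k)) = 1" using \<phi>[of k] \<omega> by (simp add: norm_mult)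
    then have "\<omega> * cnj (\<phi> $ k) \<noteq> 0" by (metis norm_zero zero_neq_one)
    then have "cis (a $ k) = sgn (\<omega> * cnj (\<phi> $ k))" unfolding a_def vec_lambda_beta by (rule cis_Arg)
    then show ?thesis using one by (simp add: sgn_eq)
  qed
  have U_eq: "U = phase_reflection \<alpha> v ** diag_mat (\<chi> k. cis (a $ k))"
  proof -
    have "U $ i $ j = phase_reflection \<alpha> v $ i $ j * cis (a $ j)" for i j
    proof -
      have "\<phi> $ j * cnj (\<phi> $ j) = 1" using \<phi>[of j] by (simp flip: complex_norm_square)
      then have "U $ i $ j = A $ i $ j * cnj (\<phi> $ j)"
        by (simp add: A_def mul_diag_mat_nth mult.assoc)
      then show ?thesis unfolding form cis_a by simp
    qed
    then show ?thesis by (simp add: vec_eq_iff mul_diag_mat_nth)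
  qed
  have unit: "(\<Sum>k\<in>UNIV. (cmod (v $ k))\<^sup>2) = 1" using v by (simp add: power_divide)
  have "1 = cis (- \<alpha>) * cis (\<Sum>k\<in>UNIV. a $ k)"
    using U arg_cong[OF U_eq, of det]
    by (simp add: special_unitary_def det_mul det_phase_reflection[OF unit] det_diag_mat cis_sum)
  then have "cis \<alpha> * 1 = cis \<alpha> * (cis (- \<alpha>) * cis (\<Sum>k\<in>UNIV. a $ k))" by simp
  then have "cis (\<Sum>k\<in>UNIV. a $ k) = cis \<alpha>" by (simp add: cis_mult)
  then show "\<exists>(v :: complex ^ 'n) (a :: real ^ 'n). (\<forall>k. cmod (v $ k) = 1 / sqrt (real CARD('n)))
        \<and> cis (\<Sum>k\<in>UNIV. a $ k) = cis \<alpha>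
        \<and> U = phase_reflection \<alpha> v ** diag_mat (\<chi> k. cis (a $ k))"
    using v U_eq by blast
qed

lemma diag_prod_phase_reflection_mul:
  fixes v :: "complex ^ 'n"
  assumes v: "\<forall>k. cmod (v $ k) = 1 / sqrt (real CARD('n))" and a: "cis (\<Sum>k\<in>UNIV. a $ k) = cis \<alpha>"
  shows "diag_prod (phase_reflection \<alpha> v ** diag_mat (\<chi> k. cis (a $ k))) = gamma_curve CARD('n) \<alpha>"
proof -
  have "v $ k * cnj (v $ k) = of_real (1 / real CARD('n))" for k
    using v by (simp only: complex_norm_square[symmetric]) (simp add: power_divide)
  then have "phase_reflection \<alpha> v $ k $ k = curve_base CARD('n) \<alpha>" for k
    by (simp add: phase_reflection_nth mat_def curve_base_def)
  then show ?thesis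
    by (simp add: diag_prod_def mul_diag_mat_nth prod.distrib cis_sum[symmetric] a gamma_curve_base)
qed

text \<open>The determinant of the phase reflection is compensated in a single diagonal entry.\<close>

lemma diag_prod_special_unitary_phase_reflection:
  fixes v :: "complex ^ 'n"
  assumes "(\<Sum>k\<in>UNIV. (cmod (v $ k))\<^sup>2) = 1"
  shows "cis \<alpha> * (\<Prod>k\<in>UNIV. 1 - (1 - cis (- \<alpha>)) * of_real ((cmod (v $ k))\<^sup>2)) \<in> diag_prod ` (special_unitary :: (complex ^ 'n ^ 'n) set)"
proof -
  obtain k0 :: 'n where True by simp
  define e where "e = (\<chi> k. if k = k0 then cis \<alpha> else 1)"
  let ?U = "phase_reflection \<alpha> v ** diag_mat e"
  have "\<And>k. cmod (e $ k) = 1" by (simp add: e_def)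
  then have "?U \<in> unitary_matrices"
    by (intro unitary_matrices_mul phase_reflection_unitary diag_mat_unitary assms)
  moreover have prod_e: "(\<Prod>k\<in>UNIV. e $ k) = cis \<alpha>" by (simp add: e_def)
  then have "det ?U = 1"
    by (simp add: det_mul det_phase_reflection[OF assms] det_diag_mat cis_mult)
  ultimately have "?U \<in> special_unitary" by (simp add: special_unitary_iff)
  moreover have "diag_prod ?U = cis \<alpha> * (\<Prod>k\<in>UNIV. 1 - (1 - cis (- \<alpha>)) * of_real ((cmod (v $ k))\<^sup>2))"
    unfolding diag_prod_def mul_diag_mat_nth prod.distrib prod_e phase_reflection_nth complex_norm_square
    by (simp add: mat_def)
  ultimately show ?thesis by (metis image_eqI)
qed

lemma gamma_curve_in_image:
  "gamma_curve CARD('n) \<alpha> \<in> diag_prod ` (special_unitary :: (complex ^ 'n ^ 'n) set)"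
proof -
  let ?v = "\<chi> k. of_real (1 / sqrt (real CARD('n))) :: complex ^ 'n"
  have sq: "(cmod (?v $ k))\<^sup>2 = 1 / real CARD('n)" for k
    by (simp only: vec_lambda_beta norm_of_real) (simp add: power_divide)
  then have "cis \<alpha> * (\<Prod>k\<in>(UNIV::'n set). 1 - (1 - cis (- \<alpha>)) * of_real (1 / real CARD('n)))
      \<in> diag_prod ` (special_unitary :: (complex ^ 'n ^ 'n) set)"
    using diag_prod_special_unitary_phase_reflection[of ?v \<alpha>] by (simp only: sq) simp
  then show ?thesis by (simp add: gamma_curve_def)
qed

section \<open>The region enclosed by the curve\<close>

lemma simple_path_gamma_curve:
  assumes "n \<ge> 3"
  shows "simple_path (\<lambda>t. gamma_curve n (2 * pi * t - pi))"
    and "path_image (\<lambda>t. gamma_curve n (2 * pi * t - pi)) = gamma_curve n ` {-pi..pi}"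
proof -
  have range: "2 * pi * t - pi \<in> {-pi..pi}" if "t \<in> {0..1}" for t
    using that mult_left_le[of t "2 * pi"] by auto
  show "simple_path (\<lambda>t. gamma_curve n (2 * pi * t - pi))"
    unfolding simple_path_def loop_free_def
  proof (intro conjI ballI impI)
    show "path (\<lambda>t. gamma_curve n (2 * pi * t - pi))"
      unfolding path_def
      by (rule continuous_on_compose2[OF continuous_on_gamma_curve _ subset_UNIV]) (intro continuous_intros)
  next
    fix x y :: real
    assume x: "x \<in> {0..1}" and y: "y \<in> {0..1}"
      and "gamma_curve n (2 * pi * x - pi) = gamma_curve n (2 * pi * y - pi)"
    then have "2 * pi * x - pi = 2 * pi * y - pi \<or> {2 * pi * x - pi, 2 * pi * y - pi} = {-pi, pi}"
      using gamma_curve_angle_unique(1)[OF assms range[OF x] range[OF y], of 1 1] by simp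
    then show "x = y \<or> x = 0 \<and> y = 1 \<or> x = 1 \<and> y = 0"
      by (auto simp: doubleton_eq_iff)
  qed
  have "(\<lambda>t. 2 * pi * t - pi) ` {0..1} = {-pi..pi}"
  proof (intro equalityI subsetI)
    fix a assume "a \<in> {-pi..pi}"
    then have "a = 2 * pi * ((a + pi) / (2 * pi)) - pi" "(a + pi) / (2 * pi) \<in> {0..1}"
      by (auto simp: field_simps)
    then show "a \<in> (\<lambda>t. 2 * pi * t - pi) ` {0..1}" by (rule image_eqI)
  qed (use range in blast)
  then show "path_image (\<lambda>t. gamma_curve n (2 * pi * t - pi)) = gamma_curve n ` {-pi..pi}"
    unfolding path_image_def by (metis image_image)
qed

text \<open>The closed star region \<open>R\<close> and the closed set \<open>X\<close> of points on or beyond the curve cover the plane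
  and meet only on the curve.  A component of the complement that meets \<open>R\<close> therefore stays in \<open>R\<close>,
  which is bounded.\<close>

lemma star_region_subset_enclosed_region:
  assumes n: "n \<ge> 3" and "s \<in> {0..1}" "\<alpha> \<in> {-pi..pi}"
  shows "of_real s * gamma_curve n \<alpha> \<in> enclosed_region (gamma_curve n ` {-pi..pi})"
proof -
  let ?I = "{-pi..pi}" and ?\<gamma> = "gamma_curve n"
  let ?C = "?\<gamma> ` ?I"
  define R where "R = (\<lambda>p. of_real (fst p) * ?\<gamma> (snd p)) ` ({0..1} \<times> ?I)"
  \<comment> \<open>Inversion turns \<open>X\<close> into a part of a compact set; this is how \<open>X\<close> is seen to be closed.\<close>
  define R' where "R' = (\<lambda>p. of_real (fst p) / ?\<gamma> (snd p)) ` ({0..1} \<times> ?I)"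
  define X where "X = {of_real s * ?\<gamma> a |s a. 1 \<le> s \<and> a \<in> ?I}"
  have cont: "continuous_on S (\<lambda>p. ?\<gamma> (snd p))" for S :: "(real \<times> real) set"
    by (rule continuous_on_compose2[OF continuous_on_gamma_curve continuous_on_snd[OF continuous_on_id] subset_UNIV])
  have "compact R" "compact R'"
    unfolding R_def R'_def using gamma_curve_nonzero[OF n]
    by (intro compact_continuous_image compact_Times compact_Icc continuous_on_mult continuous_on_divide
        continuous_on_of_real continuous_on_fst continuous_on_id cont; blast)+
  obtain a0 where a0: "a0 \<in> ?I" "\<And>a. a \<in> ?I \<Longrightarrow> cmod (?\<gamma> a0) \<le> cmod (?\<gamma> a)"
    using continuous_attains_inf[OF compact_Icc _ continuous_on_norm[OF continuous_on_gamma_curve], of "-pi" pi n]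
    by auto
  have "X = (- ball 0 (cmod (?\<gamma> a0))) \<inter> inverse -` R'"
  proof (intro equalityI subsetI)
    fix w assume "w \<in> X"
    then obtain s a where s: "1 \<le> s" and a: "a \<in> ?I" and w: "w = of_real s * ?\<gamma> a" by (auto simp: X_def)
    have "1 * cmod (?\<gamma> a0) \<le> s * cmod (?\<gamma> a)" using s a0(2)[OF a] by (intro mult_mono) auto
    then have "w \<notin> ball 0 (cmod (?\<gamma> a0))" using s by (simp add: w norm_mult)
    moreover have "inverse w \<in> R'"
      unfolding R'_def
      by (rule image_eqI[where x = "(1 / s, a)"]) (use s a in \<open>auto simp: w divide_inverse intro: inverse_le_1_iff[THEN iffD2]\<close>)
    ultimately show "w \<in> (- ball 0 (cmod (?\<gamma> a0))) \<inter> inverse -` R'" by simp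
  next
    fix w assume w: "w \<in> (- ball 0 (cmod (?\<gamma> a0))) \<inter> inverse -` R'"
    then have "cmod (?\<gamma> a0) \<le> cmod w" by simp
    moreover have "0 < cmod (?\<gamma> a0)" using gamma_curve_nonzero[OF n, of a0] by simp
    ultimately have w0: "w \<noteq> 0" by auto
    obtain s a where s: "0 \<le> s" "s \<le> 1" and a: "a \<in> ?I" and inv: "inverse w = of_real s / ?\<gamma> a"
      using w by (auto simp: R'_def)
    have "s \<noteq> 0" using inv w0 by auto
    then have "1 \<le> 1 / s" using s by simp
    moreover have "w = of_real (1 / s) * ?\<gamma> a"
      using arg_cong[OF inv, of inverse] by (simp add: field_simps)
    ultimately show "w \<in> X" using a unfolding X_def by blast
  qed
  moreover have "closed ((- ball 0 (cmod (?\<gamma> a0))) \<inter> inverse -` R')"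
  proof (rule continuous_closed_preimage)
    have "0 < cmod (?\<gamma> a0)" using gamma_curve_nonzero[OF n, of a0] by simp
    then show "continuous_on (- ball 0 (cmod (?\<gamma> a0))) (inverse :: complex \<Rightarrow> complex)"
      by (intro continuous_on_inverse continuous_on_id ballI) auto
    show "closed (- ball 0 (cmod (?\<gamma> a0)))" by (simp add: closed_def)
    show "closed R'" using \<open>compact R'\<close> by (rule compact_imp_closed)
  qed
  ultimately have "closed X" by simp
  have cover: "w \<in> R \<union> X" for w
  proof (cases "w = 0")
    case True
    have "w \<in> R"
      unfolding R_def by (rule image_eqI[where x = "(0, 0)"]) (use True in auto)
    then show ?thesis by blast
  next
    case False
    then obtain a E where a: "a \<in> ?I" and E: "E > 0" "w = of_real E * ?\<gamma> a"
      using complex_polar_gamma_curve[OF n] by metis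
    show ?thesis
    proof (cases "E \<le> 1")
      case True
      have "w \<in> R"
        unfolding R_def by (rule image_eqI[where x = "(E, a)"]) (use True E a in auto)
      then show ?thesis by blast
    next
      case False
      then have "1 \<le> E" by simp
      then have "w \<in> X" using a E(2) unfolding X_def by blast
      then show ?thesis by blast
    qed
  qed
  have overlap: "R \<inter> X \<subseteq> ?C"
  proof
    fix w assume w: "w \<in> R \<inter> X"
    then obtain s a s' a' where s: "0 \<le> s" "s \<le> 1" "a \<in> ?I" "w = of_real s * ?\<gamma> a"
      and s': "1 \<le> s'" "a' \<in> ?I" "w = of_real s' * ?\<gamma> a'"
      by (auto simp: R_def X_def)
    have "s \<noteq> 0" using s s' gamma_curve_nonzero[OF n, of a'] by auto
    then have "s = s'" using gamma_curve_angle_unique(2)[OF n s(3) s'(2), of s s'] s s' by auto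
    then have "s = 1" using s s' by simp
    then show "w \<in> ?C" using s by auto
  qed
  let ?z = "of_real s * ?\<gamma> \<alpha>"
  have zR: "?z \<in> R"
    unfolding R_def by (rule image_eqI[where x = "(s, \<alpha>)"]) (use assms in auto)
  have "?z \<in> inside ?C" if "?z \<notin> ?C"
  proof -
    let ?K = "connected_component_set (- ?C) ?z"
    have zK: "?z \<in> ?K" using that by simp
    have "?K \<subseteq> - ?C" by (rule connected_component_subset)
    then have "R \<inter> X \<inter> ?K = {}" using overlap by blast
    moreover have "?K \<subseteq> R \<union> X" using cover by blast
    moreover have "connected ?K" by (rule connected_connected_component)
    moreover have "closed R" using \<open>compact R\<close> by (rule compact_imp_closed)
    ultimately have "R \<inter> ?K = {} \<or> X \<inter> ?K = {}"
      using \<open>closed X\<close> unfolding connected_closed by blast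
    then have "X \<inter> ?K = {}" using zR zK by blast
    then have "?K \<subseteq> R" using cover by blast
    then have "bounded ?K" using \<open>compact R\<close> bounded_subset compact_imp_bounded by blast
    then show ?thesis using that by (simp add: inside_def)
  qed
  then show ?thesis by (auto simp: enclosed_region_def)
qed

text \<open>The squared moduli \<open>p k s\<close> of the entries of \<open>v\<close> deform from the uniform distribution to a point mass.
  Along the way the curve of diagonal products contracts within the image from \<open>gamma_curve\<close> to the
  constant \<open>1\<close>, so a point missed by the image has winding number zero.  A point inside a simple
  closed curve does not.\<close>

lemma inside_gamma_curve_subset_image:
  assumes n: "CARD('n::finite) \<ge> 3" and z: "z \<in> inside (gamma_curve CARD('n) ` {-pi..pi})"
  shows "z \<in> diag_prod ` (special_unitary :: (complex ^ 'n ^ 'n) set)"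
proof (rule ccontr)
  assume no: "z \<notin> diag_prod ` (special_unitary :: (complex ^ 'n ^ 'n) set)"
  let ?g = "\<lambda>t. gamma_curve CARD('n) (2 * pi * t - pi)"
  obtain k0 :: 'n where True by simp
  define p where "p k s = (1 - s) / real CARD('n) + (if k = k0 then 1 else 0) * s" for k and s :: real
  define h where "h q = cis (2 * pi * snd q - pi) *
      (\<Prod>k\<in>UNIV. 1 - (1 - cis (- (2 * pi * snd q - pi))) * of_real (p k (fst q)))" for q :: "real \<times> real"
  have p0: "p k s \<ge> 0" if "s \<in> {0..1}" for k s
    using that by (auto simp: p_def)
  have p_sum: "(\<Sum>k\<in>UNIV. p k s) = 1" for s
    by (simp add: p_def sum.distrib sum_distrib_right[symmetric])
  have "h q \<in> diag_prod ` (special_unitary :: (complex ^ 'n ^ 'n) set)" if "q \<in> {0..1} \<times> {0..1}" for q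
  proof -
    let ?v = "\<chi> k. complex_of_real (sqrt (p k (fst q)))"
    have sq: "(cmod (?v $ k))\<^sup>2 = p k (fst q)" for k
      using p0[of "fst q" k] that by (simp add: mem_Times_iff)
    show ?thesis
      using diag_prod_special_unitary_phase_reflection[of ?v "2 * pi * snd q - pi"]
      unfolding sq h_def by (simp add: p_sum)
  qed
  then have "h \<in> {0..1} \<times> {0..1} \<rightarrow> - {z}" using no by blast
  moreover have "continuous_on ({0..1} \<times> {0..1}) h"
    unfolding h_def p_def cis_conv_exp by (intro continuous_intros) simp_all
  moreover have "h (0, t) = ?g t" for t
    by (simp add: h_def p_def gamma_curve_def)
  moreover have "h (1, t) = 1" for t
  proof -
    let ?a = "2 * pi * t - pi"
    have "h (1, t) = cis ?a * (\<Prod>k\<in>UNIV. if k = k0 then cis (- ?a) else 1)"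
      unfolding h_def by (intro arg_cong2[of _ _ _ _ "(*)"] prod.cong) (auto simp: p_def)
    also have "\<dots> = cis ?a * cis (- ?a)" by (subst prod.delta) auto
    finally show ?thesis by (simp only: cis_mult) simp
  qed
  moreover have "pathfinish (h \<circ> Pair t) = pathstart (h \<circ> Pair t)" for t
  proof -
    have "cis (- pi) = cis pi" by (simp add: complex_eq_iff)
    then show ?thesis by (simp add: pathfinish_def pathstart_def h_def)
  qed
  ultimately have "homotopic_loops (- {z}) ?g (\<lambda>t. 1)"
    unfolding homotopic_loops by blast
  then have "winding_number ?g z = winding_number (\<lambda>t. 1) z"
    by (rule winding_number_homotopic_loops)
  also have "\<dots> = 0"
  proof -
    have "(1::complex) \<in> diag_prod ` (special_unitary :: (complex ^ 'n ^ 'n) set)"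
      using gamma_curve_in_image[where 'n = 'n and \<alpha> = 0] by simp
    then have "z \<noteq> 1" using no by blast
    then show ?thesis using winding_number_trivial[of z 1] by (simp add: linepath_refl)
  qed
  finally have "winding_number ?g z = 0" .
  moreover have "norm (winding_number ?g z) = 1"
    using simple_closed_path_norm_winding_number_inside[OF simple_path_gamma_curve(1)[OF n]] z
    by (simp add: simple_path_gamma_curve(2)[OF n])
  ultimately show False by simp
qed

section \<open>Dimensions one and two\<close>

lemma inside_real_interval: "inside (complex_of_real ` {a..b}) = {}"
proof (rule inside_convex)
  show "convex (complex_of_real ` {a..b})"
    by (intro convex_linear_image linearI convex_real_interval) (auto simp: scaleR_conv_of_real)
qed

lemma gamma_curve_1: "gamma_curve 1 \<alpha> = 1"
  by (simp add: gamma_curve_def cis_mult)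

lemma gamma_curve_2: "gamma_curve 2 \<alpha> = of_real ((cos (\<alpha> / 2))\<^sup>2)"
proof -
  have half: "cis \<alpha> = cis (\<alpha> / 2) * cis (\<alpha> / 2)" "cis (- \<alpha>) = cis (- (\<alpha> / 2)) * cis (- (\<alpha> / 2))"
    by (simp_all add: cis_mult)
  have inv: "cis (\<alpha> / 2) * cis (- (\<alpha> / 2)) = 1" by (simp add: cis_mult)
  have "gamma_curve 2 \<alpha> = cis \<alpha> * (1 + cis (- \<alpha>))\<^sup>2 / 4"
    by (simp add: gamma_curve_def field_simps power2_eq_square)
  also have "\<dots> = ((cis (\<alpha> / 2) * (1 + cis (- \<alpha>))) / 2)\<^sup>2"
    by (simp add: half(1) power2_eq_square)
  also have "cis (\<alpha> / 2) * (1 + cis (- \<alpha>)) = cis (\<alpha> / 2) + cis (- (\<alpha> / 2))"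
    by (simp add: distrib_left cis_mult)
  also have "\<dots> = of_real (2 * cos (\<alpha> / 2))" by (simp add: complex_eq_iff)
  finally show ?thesis by (simp flip: of_real_power)
qed

text \<open>In dimension two the curve runs back and forth on a segment, which has no inside.\<close>

lemma gamma_curve_2_image: "gamma_curve 2 ` {-pi..pi} = of_real ` {0..1}"
proof (intro equalityI subsetI)
  fix w assume "w \<in> gamma_curve 2 ` {-pi..pi}"
  then show "w \<in> of_real ` {0..1}"
    by (auto simp: gamma_curve_2 power_le_one_iff abs_square_le_1 intro!: imageI simp del: of_real_power)
next
  fix w :: complex assume "w \<in> of_real ` {0..1}"
  then obtain x where x: "0 \<le> x" "x \<le> 1" "w = of_real x" by auto
  let ?a = "2 * arccos (sqrt x)"
  have "0 \<le> sqrt x" "- 1 \<le> sqrt x" "sqrt x \<le> 1"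
    using x by (simp_all add: order_trans[of "- 1" 0])
  then have "0 \<le> arccos (sqrt x)" "arccos (sqrt x) \<le> pi / 2" "cos (arccos (sqrt x)) = sqrt x"
    by (simp_all only: arccos_lbound arccos_le_pi2 cos_arccos)
  then have "?a \<in> {-pi..pi}" "w = gamma_curve 2 ?a"
    using x by (auto simp: gamma_curve_2)
  then show "w \<in> gamma_curve 2 ` {-pi..pi}" by (metis image_eqI)
qed

lemma reflection_form_in_dimension_1:
  fixes U :: "complex ^ 'n ^ 'n"
  assumes n: "CARD('n) = 1" and U: "U \<in> special_unitary"
  shows "U = phase_reflection 0 (\<chi> k. 1) ** diag_mat (\<chi> k. cis ((0 :: real ^ 'n) $ k))"
proof -
  obtain p where p: "(UNIV :: 'n set) = {p}" using n by (rule card_1_singletonE)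
  then have idx: "k = p" for k by blast
  have "det U = (\<Prod>i\<in>UNIV. U $ i $ i)"
    by (rule det_diagonal) (metis idx)
  then have "U $ p $ p = 1" using U by (simp add: p special_unitary_def)
  then have "U $ i $ j = mat 1 $ i $ j" for i j
    using idx[of i] idx[of j] by (simp add: mat_def)
  then show ?thesis by (simp add: vec_eq_iff mul_diag_mat_nth phase_reflection_nth)
qed

text \<open>For determinant one the inverse is the adjugate matrix, and it equals the conjugate transpose.\<close>

lemma special_unitary_2_entries:
  fixes U :: "complex ^ 'n ^ 'n"
  assumes pq: "(UNIV :: 'n set) = {p, q}" "p \<noteq> q" and U: "U \<in> special_unitary"
  shows "U $ q $ q = cnj (U $ p $ p)" "U $ q $ p = - cnj (U $ p $ q)"
    and "(cmod (U $ p $ p))\<^sup>2 + (cmod (U $ p $ q))\<^sup>2 = 1"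
proof -
  let ?a = "U $ p $ p" and ?b = "U $ p $ q" and ?c = "U $ q $ p" and ?d = "U $ q $ q"
  have uni: "U \<in> unitary_matrices" using U by (simp add: special_unitary_iff)
  have qs: "finite {q}" "p \<notin> {q}" using pq by auto
  have "det U = ?a * ?d - ?b * ?c"
    unfolding det_def pq(1) sum_over_permutations_insert[OF qs] permutes_sing
    using pq(2) by (simp add: sign_swap_id sign_id swap_id_eq)
  then have det: "?a * ?d - ?b * ?c = 1" using U by (simp add: special_unitary_def)
  have norm: "?a * cnj ?a + ?b * cnj ?b = 1"
    using unitary_row_orthonormal[OF uni, of p p] pq(2) by (simp add: pq(1) mat_def)
  have "?c * cnj ?a + ?d * cnj ?b = 0"
    using unitary_row_orthonormal[OF uni, of q p] pq(2) by (simp add: pq(1) mat_def)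
  then have orth: "?c * cnj ?a = - (?d * cnj ?b)" by (simp add: add_eq_0_iff)
  have "cnj ?a = cnj ?a * (?a * ?d - ?b * ?c)" by (simp add: det)
  also have "\<dots> = ?a * cnj ?a * ?d - ?b * (?c * cnj ?a)" by (simp add: algebra_simps)
  also have "\<dots> = (?a * cnj ?a + ?b * cnj ?b) * ?d" unfolding orth by (simp add: algebra_simps)
  finally show "?d = cnj ?a" by (simp add: norm)
  have "cnj ?b = cnj ?b * (?a * ?d - ?b * ?c)" by (simp add: det)
  also have "\<dots> = ?a * (?d * cnj ?b) - ?b * cnj ?b * ?c" by (simp add: algebra_simps)
  also have "?d * cnj ?b = - (?c * cnj ?a)" by (simp add: orth)
  also have "?a * - (?c * cnj ?a) - ?b * cnj ?b * ?c = - ((?a * cnj ?a + ?b * cnj ?b) * ?c)"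
    by (simp add: algebra_simps)
  finally show "?c = - cnj ?b" by (simp add: norm)
  show "(cmod ?a)\<^sup>2 + (cmod ?b)\<^sup>2 = 1"
    using unitary_row_norm[OF uni, of p] pq(2) by (simp add: pq(1))
qed

text \<open>A special unitary matrix of size two has rows \<open>(a, b)\<close> and \<open>(- cnj b, cnj a)\<close>.  The modulus of \<open>a\<close> fixes
  \<open>cos (\<alpha> / 2)\<close>, the argument of \<open>a\<close> the two phases, and the argument of \<open>b\<close> the relative phase of the
  two entries of \<open>v\<close>.\<close>

lemma reflection_form_in_dimension_2:
  fixes U :: "complex ^ 'n ^ 'n"
  assumes n: "CARD('n) = 2" and U: "U \<in> special_unitary"
  shows "\<exists>\<alpha>\<in>{-pi..pi}. \<exists>(v :: complex ^ 'n) (a :: real ^ 'n).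
      (\<forall>k. cmod (v $ k) = 1 / sqrt (real CARD('n)))
    \<and> cis (\<Sum>k\<in>UNIV. a $ k) = cis \<alpha>
    \<and> U = phase_reflection \<alpha> v ** diag_mat (\<chi> k. cis (a $ k))"
proof -
  obtain p q where pq: "(UNIV :: 'n set) = {p, q}" "p \<noteq> q" using n by (meson card_2_iff)
  then have idx: "k = p \<or> k = q" for k by blast
  note entries = special_unitary_2_entries[OF pq U]
  define \<theta> where "\<theta> = arccos (cmod (U $ p $ p))"
  have le: "cmod (U $ p $ p) \<le> 1"
    using U by (intro unitary_entry_norm_le_1) (simp add: special_unitary_iff)
  have "- 1 \<le> cmod (U $ p $ p)" using norm_ge_zero[of "U $ p $ p"] by linarith
  then have \<theta>: "0 \<le> \<theta>" "\<theta> \<le> pi / 2" and cos: "cos \<theta> = cmod (U $ p $ p)"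
    using le by (simp_all only: \<theta>_def norm_ge_zero arccos_lbound arccos_le_pi2 cos_arccos)
  then have range: "2 * \<theta> \<in> {-pi..pi}" by auto
  have "0 \<le> sin \<theta>" using \<theta> by (intro sin_ge_zero) auto
  moreover have "(sin \<theta>)\<^sup>2 = (cmod (U $ p $ q))\<^sup>2"
    using entries(3) sin_cos_squared_add[of \<theta>] by (simp add: cos)
  ultimately have sin: "sin \<theta> = cmod (U $ p $ q)" by (simp add: power2_eq_iff_nonneg)
  define A where "A = Arg (U $ p $ p)"
  define \<beta> where "\<beta> = Arg (U $ p $ q)"
  define v where "v = ((\<chi> k. of_real (1 / sqrt 2) * (if k = p then \<i> * cis (\<beta> + A) else 1)) :: complex ^ 'n)"
  define a where "a = (\<chi> k. if k = p then \<theta> + A else \<theta> - A)"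
  have polar: "z = of_real (cmod z) * cis (Arg z)" for z
    by (metis rcis_cmod_Arg rcis_def)
  have "cmod (v $ k) = 1 / sqrt (real CARD('n))" for k
    unfolding v_def vec_lambda_beta norm_mult norm_of_real n by (simp add: norm_mult)
  moreover have "cis (\<Sum>k\<in>UNIV. a $ k) = cis (2 * \<theta>)"
    using pq(2) by (simp add: pq(1) a_def)
  moreover have "U $ i $ j = phase_reflection (2 * \<theta>) v $ i $ j * cis (a $ j)" for i j
  proof -
    have half: "complex_of_real (1 / sqrt 2) * of_real (1 / sqrt 2) = 1 / 2"
      by (simp flip: of_real_mult)
    define x y where "x = cis \<theta>" and "y = cis (- \<theta>)"
    have xy: "x * y = 1" by (simp add: x_def y_def cis_mult)
    have c: "complex_of_real (cos \<theta>) = (x + y) / 2" and s: "complex_of_real (sin \<theta>) = - \<i> * (x - y) / 2"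
      by (simp_all add: x_def y_def complex_eq_iff)
    have yy: "cis (- (2 * \<theta>)) = y * y" by (simp add: y_def cis_mult)
    have AA: "cis A * cis (- A) = 1" and BB: "cis \<beta> * cis (- \<beta>) = 1" by (simp_all add: cis_mult)
    have a_p: "cis (a $ p) = x * cis A" and a_q: "cis (a $ q) = x * cis (- A)"
      using pq(2) by (simp_all add: a_def x_def cis_mult)
    have pp: "U $ p $ p = (x + y) / 2 * cis A"
      using polar[of "U $ p $ p"] unfolding cos[symmetric] c A_def by simp
    have pq': "U $ p $ q = - \<i> * (x - y) / 2 * cis \<beta>"
      using polar[of "U $ p $ q"] unfolding sin[symmetric] s \<beta>_def by simp
    have cx: "cnj x = y" "cnj y = x" by (simp_all add: x_def y_def cis_cnj)
    have vpp: "v $ p * cnj (v $ p) = 1 / 2" "v $ q * cnj (v $ q) = 1 / 2"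
      "v $ p * cnj (v $ q) = \<i> / 2 * (cis \<beta> * cis A)" "v $ q * cnj (v $ p) = - \<i> / 2 * (cis (- \<beta>) * cis (- A))"
      using pq(2) half by (simp_all add: v_def cis_mult cis_cnj algebra_simps)
    have "(1 - (1 - y * y) * (1 / 2)) * x = (x + y * (x * y)) / 2"
      by (simp add: field_simps)
    then have "(1 - (1 - y * y) * (1 / 2)) * x = (x + y) / 2" by (simp only: xy mult_1_right)
    then have diag: "(1 - (1 - y * y) * (1 / 2)) * (x * w) = (x + y) / 2 * w" for w
      by (simp only: mult.assoc[symmetric])
    have "(1 - y * y) * x = x - y * (x * y)" by (simp add: algebra_simps)
    then have xyy: "(1 - y * y) * x = x - y" by (simp only: xy mult_1_right)
    have "- ((1 - y * y) * (u * w)) * (x * w') = - ((1 - y * y) * x) * u * (w * w')" for u w w'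
      by (simp add: mult_ac)
    then have off: "- ((1 - y * y) * (u * w)) * (x * w') = - (x - y) * u * (w * w')" for u w w'
      by (simp only: xyy)
    have "U $ p $ p = phase_reflection (2 * \<theta>) v $ p $ p * cis (a $ p)"
      unfolding phase_reflection_nth yy vpp a_p pp using diag[of "cis A"] by (simp add: mat_def)
    moreover have "U $ q $ q = phase_reflection (2 * \<theta>) v $ q $ q * cis (a $ q)"
      unfolding phase_reflection_nth yy vpp a_q entries(1) pp using diag[of "cis (- A)"]
      by (simp add: mat_def cx cis_cnj add.commute)
    moreover have "U $ p $ q = phase_reflection (2 * \<theta>) v $ p $ q * cis (a $ q)"
    proof -
      have "phase_reflection (2 * \<theta>) v $ p $ q * cis (a $ q)
          = - ((1 - y * y) * ((\<i> / 2 * cis \<beta>) * cis A)) * (x * cis (- A))"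
        unfolding phase_reflection_nth yy vpp a_q using pq(2) by (simp add: mat_def)
      also have "\<dots> = - \<i> * (x - y) / 2 * cis \<beta>"
        unfolding off AA by (simp add: algebra_simps)
      finally show ?thesis unfolding pq' by simp
    qed
    moreover have "U $ q $ p = phase_reflection (2 * \<theta>) v $ q $ p * cis (a $ p)"
    proof -
      have "phase_reflection (2 * \<theta>) v $ q $ p * cis (a $ p)
          = - ((1 - y * y) * ((- \<i> / 2 * cis (- \<beta>)) * cis (- A))) * (x * cis A)"
        unfolding phase_reflection_nth yy vpp a_p using pq(2) by (simp add: mat_def)
      also have "\<dots> = \<i> * (x - y) / 2 * cis (- \<beta>)"
        unfolding off using AA by (simp add: field_simps)
      also have "\<dots> = - cnj (U $ p $ q)"
        unfolding pq' by (simp add: cx cis_cnj field_simps)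
      finally show ?thesis unfolding entries(2) by simp
    qed
    ultimately show ?thesis using idx[of i] idx[of j] by auto
  qed
  then have "U = phase_reflection (2 * \<theta>) v ** diag_mat (\<chi> k. cis (a $ k))"
    by (simp add: vec_eq_iff mul_diag_mat_nth)
  ultimately show ?thesis using range by blast
qed

section \<open>The image of the diagonal product\<close>

theorem theorem2:
  shows "diag_prod ` (special_unitary :: (complex ^ 'n ^ 'n) set)
           = enclosed_region (gamma_curve CARD('n) ` {-pi..pi})
       \<and> (\<forall>U \<in> (special_unitary :: (complex ^ 'n ^ 'n) set).
            (\<exists>\<alpha> \<in> {-pi..pi}. diag_prod U = gamma_curve CARD('n) \<alpha>)
            \<longleftrightarrow>
            (\<exists>\<alpha> \<in> {-pi..pi}. \<exists>(v :: complex ^ 'n) (a :: real ^ 'n).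
                (\<forall>k. cmod (v $ k) = 1 / sqrt (real CARD('n)))
              \<and> cis (\<Sum>k\<in>UNIV. a $ k) = cis \<alpha>
              \<and> U = (mat 1 - map_matrix ((*) (1 - cis (- \<alpha>))) (self_outer v))
                      ** diag_mat (\<chi> k. cis (a $ k))))"
proof -
  let ?I = "{-pi..pi}" and ?\<gamma> = "gamma_curve CARD('n)"
  let ?SU = "special_unitary :: (complex ^ 'n ^ 'n) set"
  define form where "form U \<alpha> \<longleftrightarrow> (\<exists>(v :: complex ^ 'n) (a :: real ^ 'n).
      (\<forall>k. cmod (v $ k) = 1 / sqrt (real CARD('n)))
    \<and> cis (\<Sum>k\<in>UNIV. a $ k) = cis \<alpha>
    \<and> U = phase_reflection \<alpha> v ** diag_mat (\<chi> k. cis (a $ k)))" for U \<alpha>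
  have on_curve: "diag_prod U = ?\<gamma> \<alpha>" if "form U \<alpha>" for U \<alpha>
    using that unfolding form_def by (auto simp: diag_prod_phase_reflection_mul)
  have curve: "?\<gamma> ` ?I \<subseteq> diag_prod ` ?SU"
    using gamma_curve_in_image by blast
  have "diag_prod ` ?SU = enclosed_region (?\<gamma> ` ?I)
      \<and> (\<forall>U\<in>?SU. \<forall>\<alpha>\<in>?I. diag_prod U = ?\<gamma> \<alpha> \<longrightarrow> (\<exists>\<alpha>\<in>?I. form U \<alpha>))"
  proof (cases "CARD('n) \<ge> 3")
    case True
    have "diag_prod U \<in> enclosed_region (?\<gamma> ` ?I)" if "U \<in> ?SU" for U
      using diag_prod_in_star_region(1)[OF True that] star_region_subset_enclosed_region[OF True] by metis
    moreover have "enclosed_region (?\<gamma> ` ?I) \<subseteq> diag_prod ` ?SU"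
      using curve inside_gamma_curve_subset_image[OF True] unfolding enclosed_region_def by blast
    moreover have "form U \<alpha>" if "U \<in> ?SU" "\<alpha> \<in> ?I" "diag_prod U = ?\<gamma> \<alpha>" for U \<alpha>
      unfolding form_def by (rule diag_prod_in_star_region(2)[OF True that])
    ultimately show ?thesis by blast
  next
    case False
    have "CARD('n) > 0" by simp
    then have "CARD('n) = 1 \<or> CARD('n) = 2" using False by linarith
    then have all: "(\<forall>U\<in>?SU. \<exists>\<alpha>\<in>?I. form U \<alpha>) \<and> inside (?\<gamma> ` ?I) = {}"
    proof
      assume n: "CARD('n) = 1"
      have "form U 0" if "U \<in> ?SU" for U
        using reflection_form_in_dimension_1[OF n that] unfolding form_def n
        by (intro exI[of _ "\<chi> k. 1"] exI[of _ "0 :: real ^ 'n"]) simp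
      moreover have "(0::real) \<in> ?I" by simp
      moreover have "?\<gamma> ` ?I = (\<lambda>_. 1) ` ?I" unfolding n by (rule image_cong[OF refl gamma_curve_1])
      then have "?\<gamma> ` ?I = {1}" by (simp add: image_constant_conv)
      then have "inside (?\<gamma> ` ?I) = {}" by (simp add: inside_convex)
      ultimately show ?thesis by blast
    next
      assume n: "CARD('n) = 2"
      have "inside (?\<gamma> ` ?I) = {}" unfolding n gamma_curve_2_image by (rule inside_real_interval)
      then show ?thesis using reflection_form_in_dimension_2[OF n] unfolding form_def by blast
    qed
    then have "diag_prod ` ?SU \<subseteq> ?\<gamma> ` ?I" using on_curve by (metis (no_types, lifting) image_subsetI rev_image_eqI)
    then show ?thesis using all curve unfolding enclosed_region_def by blast
  qed
  then have image: "diag_prod ` ?SU = enclosed_region (?\<gamma> ` ?I)"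
    and iff: "\<And>U. U \<in> ?SU \<Longrightarrow> (\<exists>\<alpha>\<in>?I. diag_prod U = ?\<gamma> \<alpha>) \<longleftrightarrow> (\<exists>\<alpha>\<in>?I. form U \<alpha>)"
    using on_curve by blast+
  show ?thesis
    by (intro conjI ballI image iff[unfolded form_def phase_reflection_def])
qed

end
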